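(* Let $k \ge 3$ be an integer and let $0=\tau_0<\tau_1<\cdots<\tau_{2k-4}<\tau_{2k-3}=1$ be fixed. Let $S^*$ be a perfect spline of degree $2k$ with knots $\tau_1,\ldots,\tau_{2k-4}$ whose $2k$-th derivative satisfies $(S^* )^{(2k)}(t)=(-1)^j$ for $t\in[\tau_j,\tau_{j+1})$, $j=0,\ldots,2k-4$; that is, $$S^*(t)=\sum_{i=0}^{2k-1}\alpha_i t^i+\frac{1}{(2k)!}\Big(t^{2k}+2\sum_{i=1}^{2k-4}(-1)^i(t-\tau_i)_+^{2k}\Big),\qquad t\in[0,1],$$ for some $\alpha_0,\ldots,\alpha_{2k-1}\in\mathbb{R}$. Then for all $t\in[0,1]$, $$\sup_{f\in C^{(2k)}[0,1],\ \|f^{(2k)}\|_\infty\le 1}|f(t)-[H_kf](t)|\ \le\ |S^*(t)-[H_kS^*](t)|.$$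
   Context: $C^{(2k)}[0,1]$ is the class of $2k$-times continuously differentiable real functions on $[0,1]$, $\|\cdot\|_\infty$ is the supremum norm on $[0,1]$, and $x_+=\max(x,0)$. A spline of degree $2k-1$ on $[0,1]$ with (simple) knots $\tau_1<\cdots<\tau_{2k-4}$ is a function in $C^{(2k-2)}[0,1]$ whose restriction to each interval $[\tau_j,\tau_{j+1}]$, $j=0,\ldots,2k-4$, is a polynomial of degree at most $2k-1$. Given a real function $f$ on $[0,1]$ that is differentiable at the points $\tau_0,\ldots,\tau_{2k-3}$ (one-sided derivatives at $0$ and $1$), $H_kf$ denotes the unique spline of degree $2k-1$ with simple knots $\tau_1,\ldots,\tau_{2k-4}$ satisfying the $4k-4$ conditions $$(H_kf)(\tau_i)=f(\tau_i),\qquad (H_kf)'(\tau_i)=f'(\tau_i),\qquad i=0,\ldots,2k-3.$$ (Existence and uniqueness of $H_kf$ follow from the Schoenberg–Whitney–Karlin–Ziegler theorem.) The $2k$-th derivative of $S^*$ is understood piecewise (as a right derivative at the knots). *)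

theory Defs
  imports
    "HOL-Analysis.Analysis"
    "HOL-Computational_Algebra.Polynomial"
begin

text \<open>
  A real function on \<open>[0,1]\<close> is represented by a function on all reals of which only the
  values on \<open>{0..1}\<close> matter; derivatives are therefore taken within \<open>{0..1}\<close>, so that they
  are one-sided at \<open>0\<close> and \<open>1\<close>.
\<close>

definition deriv01 :: "(real \<Rightarrow> real) \<Rightarrow> real \<Rightarrow> real" where
  "deriv01 f t = vector_derivative f (at t within {0..1})"

definition C_class01 :: "nat \<Rightarrow> (real \<Rightarrow> real) set" where
  "C_class01 n =
     {f. (\<forall>i<n. \<forall>t\<in>{0..1}. (deriv01 ^^ i) f differentiable (at t within {0..1})) \<and>
         continuous_on {0..1} ((deriv01 ^^ n) f)}"

text \<open>The supremum is only meaningful for functions that are bounded on \<open>[0,1]\<close>.\<close>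

definition sup_norm01 :: "(real \<Rightarrow> real) \<Rightarrow> real" where
  "sup_norm01 f = (SUP t\<in>{0..1}. \<bar>f t\<bar>)"

text \<open>
  Splines of degree \<open>d\<close> on \<open>[0,1]\<close> with the \<open>m\<close> simple knots \<open>\<tau> 1, \<dots>, \<tau> m\<close>; the
  endpoints are \<open>\<tau> 0 = 0\<close> and \<open>\<tau> (m + 1) = 1\<close>.  Only degrees \<open>d \<ge> 1\<close> are meaningful,
  since \<open>d - 1\<close> is truncated subtraction.
\<close>

definition splines01 :: "nat \<Rightarrow> nat \<Rightarrow> (nat \<Rightarrow> real) \<Rightarrow> (real \<Rightarrow> real) set" where
  "splines01 d m \<tau> =
     {s \<in> C_class01 (d - 1).
        \<forall>j\<le>m. \<exists>p :: real poly. degree p \<le> d \<and> (\<forall>t\<in>{\<tau> j..\<tau> (Suc j)}. s t = poly p t)}"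

text \<open>
  Membership in \<open>extensional {0..1}\<close> fixes the irrelevant values outside \<open>[0,1]\<close>, without which
  the interpolating spline would not be unique as a function on all reals.
\<close>

definition hermite_spline :: "nat \<Rightarrow> (nat \<Rightarrow> real) \<Rightarrow> (real \<Rightarrow> real) \<Rightarrow> real \<Rightarrow> real" where
  "hermite_spline k \<tau> f =
     (THE s. s \<in> splines01 (2*k - 1) (2*k - 4) \<tau> \<and> s \<in> extensional {0..1} \<and>
        (\<forall>i\<le>2*k - 3. s (\<tau> i) = f (\<tau> i) \<and> deriv01 s (\<tau> i) = deriv01 f (\<tau> i)))"

end

theory Submission
  imports Defs "Jordan_Normal_Form.Determinant"
begin

text \<open>
  Write \<open>m = 2k - 4\<close>, so that splines have degree \<open>m + 3\<close>, the perfect spline \<open>S\<close> has degree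
  \<open>m + 4\<close>, and the nodes are \<open>\<tau> 0, \<dots>, \<tau> (m + 1)\<close>.

  The comparison is a zero count (\<open>perfect_error_maximal\<close>).  Let \<open>e\<close> be the interpolation error of
  \<open>S\<close> and \<open>d\<close> that of \<open>f\<close>, and suppose \<open>\<bar>d t\<bar> > \<bar>e t\<bar>\<close> for some \<open>t\<close>.  With \<open>c = e t / d t\<close>, so
  \<open>\<bar>c\<bar> < 1\<close>, the function \<open>e - c d\<close> has double zeros at the \<open>m + 2\<close> nodes and an additional zero at
  \<open>t\<close>.  Rolle's theorem gives \<open>2m + 4\<close> distinct zeros of the first derivative and then \<open>m + 3\<close> zeros
  of the derivative \<open>u\<close> of order \<open>m + 2\<close>, the last one that is continuous.  On the piece
  between \<open>\<tau> j\<close> and \<open>\<tau> (j + 1)\<close> the second derivative of \<open>u\<close> is \<open>(-1)\<^sup>j - c f\<^bsup>(m+4)\<^esup>\<close>, which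
  has the sign \<open>(-1)\<^sup>j\<close>.  Hence \<open>u\<close> is alternately strictly convex and strictly concave, and such a
  function has at most \<open>m + 2\<close> zeros (\<open>card_zeros_alternately_convex\<close>): to profit from two zeros in
  every piece it would have to be positive and negative at the same knot.  The count compares only
  signs of \<open>u\<close> at the knots, and so tolerates the jumps of \<open>u'\<close> there.

  That the interpolating spline exists and is unique has to be proved as well.  A spline with vanishing Hermite
  data is zero (\<open>spline_hermite_unique\<close>).  If it vanishes on one piece, it has a zero of
  order \<open>m + 3\<close> at an end of the adjacent piece, which together with the value zero at the other end makes
  it vanish there too.  If it is nonzero somewhere in each of the \<open>m + 1\<close> pieces, its second
  derivative has at least \<open>2m + 2\<close> strict sign changes, so the derivative of order \<open>m + 2\<close> has at
  least \<open>m + 2\<close>; but that derivative is piecewise affine with \<open>m + 1\<close> pieces and has at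
  most \<open>m + 1\<close>.  Strict sign changes replace zeros here because the derivatives of a spline may
  vanish on whole intervals.  Existence follows, since the Hermite conditions form a square linear
  system in the monomials and truncated powers (\<open>spline_hermite_exists\<close>).
\<close>

section \<open>Chains of derivatives on the unit interval\<close>

text \<open>
  Smoothness is carried by an explicit sequence of derivatives, which, unlike iterates of
  \<open>deriv01\<close>, can be added, scaled and written down for truncated powers by formula.
\<close>
definition derivs01 :: "nat \<Rightarrow> (nat \<Rightarrow> real \<Rightarrow> real) \<Rightarrow> bool" where
  "derivs01 n F \<longleftrightarrow>
     (\<forall>i<n. \<forall>t\<in>{0..1}. (F i has_real_derivative F (Suc i) t) (at t within {0..1})) \<and>
     continuous_on {0..1} (F n)"

lemma derivs01D:
  assumes "derivs01 n F" "i < n" "t \<in> {0..1}"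
  shows "(F i has_real_derivative F (Suc i) t) (at t within {0..1})"
  using assms by (auto simp: derivs01_def)

lemma derivs01_diff:
  assumes "derivs01 n F" "derivs01 n G"
  shows "derivs01 n (\<lambda>i t. F i t - G i t)"
  using assms unfolding derivs01_def
  by (blast intro: DERIV_diff continuous_on_diff)

lemma derivs01_cmult:
  assumes "derivs01 n F"
  shows "derivs01 n (\<lambda>i t. c * F i t)"
  using assms unfolding derivs01_def
  by (blast intro: DERIV_cmult continuous_on_mult_left)

lemma derivs01_add:
  assumes "derivs01 n F" "derivs01 n G"
  shows "derivs01 n (\<lambda>i t. F i t + G i t)"
  using assms unfolding derivs01_def
  by (blast intro: DERIV_add continuous_on_add)

lemma derivs01_sum:
  assumes "\<And>a. a \<in> A \<Longrightarrow> derivs01 n (F a)"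
  shows "derivs01 n (\<lambda>i t. \<Sum>a\<in>A. F a i t)"
  using assms unfolding derivs01_def
  by (intro conjI allI impI ballI DERIV_sum continuous_on_sum) blast+

lemma derivs01_mono:
  assumes "derivs01 n F" "m \<le> n"
  shows "derivs01 m F"
proof (cases "m = n")
  case False
  with assms have "m < n" by simp
  then have "continuous_on {0..1} (F m)"
    using derivs01D[OF assms(1)] by (intro DERIV_continuous_on) auto
  then show ?thesis using assms by (auto simp: derivs01_def)
qed (use assms in simp)

lemma C_class01_derivs01:
  assumes "f \<in> C_class01 n"
  shows "derivs01 n (\<lambda>i. (deriv01 ^^ i) f)"
  using assms
  by (simp add: C_class01_def derivs01_def has_real_derivative_iff_has_vector_derivative
      vector_derivative_works deriv01_def[abs_def])

lemma deriv01_eqI: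
  assumes "(F has_real_derivative D) (at t within {0..1})" "t \<in> {0..1}"
    and "\<And>x. x \<in> {0..1} \<Longrightarrow> f x = F x"
  shows "f differentiable (at t within {0..1})" "deriv01 f t = D"
proof -
  have *: "(f has_vector_derivative D) (at t within {0..1})"
    using assms(2,3) assms(1)[unfolded has_real_derivative_iff_has_vector_derivative]
    by (rule has_vector_derivative_transform)
  then show "f differentiable (at t within {0..1})" by (rule differentiableI_vector)
  show "deriv01 f t = D" unfolding deriv01_def
    using vector_derivative_within_cbox[of 0 1 t f D] * assms(2) by simp
qed

lemma derivs01_higher_deriv01:
  assumes "derivs01 n F" "\<And>t. t \<in> {0..1} \<Longrightarrow> f t = F 0 t" "i \<le> n" "t \<in> {0..1}"
  shows "(deriv01 ^^ i) f t = F i t"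
  using assms(3,4)
proof (induction i arbitrary: t)
  case 0
  then show ?case using assms(2) by simp
next
  case (Suc i)
  then show ?case
    using deriv01_eqI(2)[OF derivs01D[OF assms(1), of i t], of "(deriv01 ^^ i) f"] by simp
qed

lemma derivs01_C_class01:
  assumes "derivs01 n F" "\<And>t. t \<in> {0..1} \<Longrightarrow> f t = F 0 t"
  shows "f \<in> C_class01 n"
  unfolding C_class01_def
proof safe
  note eq = derivs01_higher_deriv01[OF assms]
  fix i and t :: real assume "i < n" "t \<in> {0..1}"
  then show "(deriv01 ^^ i) f differentiable (at t within {0..1})"
    using deriv01_eqI(1)[OF derivs01D[OF assms(1), of i t], of "(deriv01 ^^ i) f"] eq[of i] by simp
next
  have "continuous_on {0..1} (F n)" using assms(1) by (simp add: derivs01_def)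
  then show "continuous_on {0..1} ((deriv01 ^^ n) f)"
    by (rule continuous_on_eq) (rule derivs01_higher_deriv01[OF assms, symmetric], simp_all)
qed

lemma derivs01_poly: "derivs01 n (\<lambda>i. poly ((pderiv ^^ i) p))"
  unfolding derivs01_def
  by (auto intro: continuous_on_poly continuous_on_id DERIV_subset[OF poly_DERIV])

text \<open>
  The derivative of order \<open>n\<close> is covered up to the end points of the piece, also where it is
  the last continuous one, because one-sided derivatives on an interval are already unique.
\<close>
lemma derivs01_piece_poly:
  assumes F: "derivs01 n F" and ab: "0 \<le> a" "a < b" "b \<le> 1"
    and eq: "\<And>t. t \<in> {a..b} \<Longrightarrow> F 0 t = poly p t"
    and "i \<le> n" "t \<in> {a..b}"
  shows "F i t = poly ((pderiv ^^ i) p) t"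
  using assms(6,7)
proof (induction i arbitrary: t)
  case 0
  then show ?case using eq by simp
next
  case (Suc i)
  let ?q = "(pderiv ^^ i) p"
  have "(F i has_real_derivative F (Suc i) t) (at t within {a..b})"
    by (rule DERIV_subset[OF derivs01D[OF F]]) (use Suc ab in auto)
  then have 1: "(F i has_vector_derivative F (Suc i) t) (at t within cbox a b)"
    by (simp add: has_real_derivative_iff_has_vector_derivative)
  have "(poly ?q has_real_derivative poly (pderiv ?q) t) (at t within {a..b})"
    by (rule DERIV_subset[OF poly_DERIV]) auto
  then have "(poly ?q has_vector_derivative poly (pderiv ?q) t) (at t within cbox a b)"
    by (simp add: has_real_derivative_iff_has_vector_derivative)
  moreover have "F i x = poly ?q x" if "x \<in> cbox a b" for x
    using Suc.IH[of x] Suc.prems that by simp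
  ultimately have 2: "(F i has_vector_derivative poly (pderiv ?q) t) (at t within cbox a b)"
    using Suc.prems by (metis has_vector_derivative_transform interval_cbox)
  show ?case
    using vector_derivative_unique_within_closed_interval[OF ab(2) _ 1 2] Suc.prems by simp
qed

lemma mvt_real:
  fixes f :: "real \<Rightarrow> real"
  assumes "x < y" "{x..y} \<subseteq> A"
    and "\<And>t. t \<in> {x..y} \<Longrightarrow> (f has_real_derivative f' t) (at t within A)"
  obtains z where "x < z" "z < y" "f y - f x = (y - x) * f' z"
proof -
  have "\<exists>z\<in>{x<..<y}. f y - f x = (*) (f' z) (y - x)"
    using assms(1)
  proof (rule mvt_simple)
    fix t assume "x \<le> t" "t \<le> y"
    then have "(f has_real_derivative f' t) (at t within {x..y})"
      using assms by (intro DERIV_subset[OF assms(3)]) auto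
    then show "(f has_derivative (*) (f' t)) (at t within {x..y})"
      by (simp add: has_field_derivative_def)
  qed
  then show ?thesis using that by (auto simp: mult.commute)
qed

lemma mvt_derivs01:
  assumes "derivs01 n F" "i < n" "0 \<le> x" "x < y" "y \<le> 1"
  obtains z where "x < z" "z < y" "F i y - F i x = (y - x) * F (Suc i) z"
  by (rule mvt_real[of x y "{0..1}" "F i" "F (Suc i)"]) (use assms derivs01D in auto)

text \<open>
  The new zeros lie strictly between consecutive old ones, hence are disjoint from them.  This
  is what lets the derivative of a function with double zeros collect both kinds.
\<close>
lemma Rolle_finite:
  assumes F: "derivs01 n F" "i < n"
    and Z: "finite Z" "Z \<noteq> {}" "Z \<subseteq> {0..1}" "\<And>z. z \<in> Z \<Longrightarrow> F i z = 0"
  shows "\<exists>Y. finite Y \<and> Y \<subseteq> {0..<Max Z} \<and> Y \<inter> Z = {} \<and> (\<forall>y\<in>Y. F (Suc i) y = 0) \<and>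
    card Z = Suc (card Y)"
  using Z
proof (induction Z rule: finite_linorder_max_induct)
  case empty
  then show ?case by simp
next
  case (insert b A)
  show ?case
  proof (cases "A = {}")
    case True
    then show ?thesis by (intro exI[of _ "{}"]) auto
  next
    case False
    then obtain Y where Y: "finite Y" "Y \<subseteq> {0..<Max A}" "Y \<inter> A = {}"
      "\<forall>y\<in>Y. F (Suc i) y = 0" "card A = Suc (card Y)"
      using insert by auto
    have M: "Max A \<in> A" "Max A < b" using False insert by auto
    have "0 \<le> Max A" "b \<le> 1" using M insert.prems by auto
    from mvt_derivs01[OF F this(1) M(2) this(2)]
    obtain z where z: "Max A < z" "z < b" "F i b - F i (Max A) = (b - Max A) * F (Suc i) z"
      by blast
    have "F (Suc i) z = 0" using z M insert.prems by auto
    have "z \<notin> A" using z insert by (meson Max_ge leD)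
    have "Max (insert b A) = b" using insert M by (intro Max_eqI) auto
    moreover have "card (insert b A) = Suc (card (insert z Y))"
    proof -
      have "z \<notin> Y" "b \<notin> A" using Y z insert by auto
      then show ?thesis using Y insert by simp
    qed
    ultimately show ?thesis
      using Y z M insert.hyps insert.prems(2) \<open>F (Suc i) z = 0\<close> \<open>z \<notin> A\<close> \<open>0 \<le> Max A\<close>
      by (intro exI[of _ "insert z Y"]) (auto simp: subset_iff)
  qed
qed

lemma Rolle_iterated:
  assumes F: "derivs01 n F" "i + j \<le> n"
    and Z: "finite Z" "Z \<subseteq> {0..1}" "\<And>z. z \<in> Z \<Longrightarrow> F i z = 0" "card Z = N + j" "N > 0"
  shows "\<exists>Y. finite Y \<and> Y \<subseteq> {0..1} \<and> (\<forall>y\<in>Y. F (i + j) y = 0) \<and> card Y = N"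
  using F(2) Z
proof (induction j arbitrary: i Z)
  case 0
  then show ?case by auto
next
  case (Suc j)
  have "Z \<noteq> {}" using Suc.prems by auto
  then obtain Y where Y: "finite Y" "Y \<subseteq> {0..<Max Z}" "\<forall>y\<in>Y. F (Suc i) y = 0"
    "card Z = Suc (card Y)"
    using Rolle_finite[OF F(1), of i Z] Suc.prems by auto
  have "Max Z \<in> Z" using Suc.prems \<open>Z \<noteq> {}\<close> by simp
  then have "Max Z \<le> 1" using Suc.prems by auto
  then have "Y \<subseteq> {0..1}" using Y by auto
  then show ?case using Suc.IH[of "Suc i" Y] Suc.prems Y by auto
qed

section \<open>Zeros of alternately convex functions\<close>

text \<open>
  The only consequence of strict convexity that the zero count uses.
\<close>
definition strictly_below_zero_between :: "(real \<Rightarrow> real) \<Rightarrow> real \<Rightarrow> real \<Rightarrow> bool" where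
  "strictly_below_zero_between w a b \<longleftrightarrow>
     (\<forall>x y z. a \<le> x \<longrightarrow> x < y \<longrightarrow> y < z \<longrightarrow> z \<le> b \<longrightarrow> w x \<le> 0 \<longrightarrow> w z \<le> 0 \<longrightarrow> w y < 0)"

text \<open>
  If \<open>w y \<ge> 0\<close>, the mean slopes on the two sides of \<open>y\<close> would be \<open>\<ge> 0\<close> and then \<open>\<le> 0\<close>, while
  the slope is strictly increasing.
\<close>
lemma positive_deriv2_below_zero_between:
  fixes w :: "real \<Rightarrow> real"
  assumes d1: "\<And>t. t \<in> {a..b} \<Longrightarrow> (w has_real_derivative w1 t) (at t within {a..b})"
    and d2: "\<And>t. t \<in> {a..b} \<Longrightarrow> (w1 has_real_derivative w2 t) (at t within {a..b})"
    and pos: "\<And>t. t \<in> {a..b} \<Longrightarrow> w2 t > 0"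
  shows "strictly_below_zero_between w a b"
  unfolding strictly_below_zero_between_def
proof (intro allI impI, rule ccontr)
  fix x y z assume *: "a \<le> x" "x < y" "y < z" "z \<le> b" "w x \<le> 0" "w z \<le> 0" "\<not> w y < 0"
  obtain p where p: "x < p" "p < y" "w y - w x = (y - x) * w1 p"
    by (rule mvt_real[of x y "{a..b}" w w1, OF _ _ d1]) (use * in auto)
  obtain q where q: "y < q" "q < z" "w z - w y = (z - y) * w1 q"
    by (rule mvt_real[of y z "{a..b}" w w1, OF _ _ d1]) (use * in auto)
  obtain r where r: "p < r" "r < q" "w1 q - w1 p = (q - p) * w2 r"
    by (rule mvt_real[of p q "{a..b}" w1 w2, OF _ _ d2]) (use * p q in auto)
  have "w2 r > 0" using * p q r by (intro pos) auto
  then have "(q - p) * w2 r > 0" using p q by simp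
  then have "w1 p < w1 q" using r by simp
  moreover have "(y - x) * w1 p \<ge> 0" using p * by linarith
  then have "w1 p \<ge> 0" using * by (simp add: zero_le_mult_iff)
  moreover have "(z - y) * w1 q \<le> 0" using q * by linarith
  then have "w1 q \<le> 0" using * by (simp add: mult_le_0_iff)
  ultimately show False by simp
qed

lemma strictly_below_zero_between_cong:
  assumes "\<And>t. t \<in> {a..b} \<Longrightarrow> v t = w t" "strictly_below_zero_between w a b"
  shows "strictly_below_zero_between v a b"
  unfolding strictly_below_zero_between_def
proof (intro allI impI)
  fix x y z assume *: "a \<le> x" "x < y" "y < z" "z \<le> b" "v x \<le> 0" "v z \<le> 0"
  then have "v x = w x" "v y = w y" "v z = w z" by (simp_all add: assms(1))
  then show "v y < 0" using * assms(2) unfolding strictly_below_zero_between_def by metis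
qed

text \<open>
  The polynomial contributes \<open>(-1)\<^sup>j\<close> to the second derivative, and the perturbation \<open>c g\<close> with
  \<open>\<bar>c\<bar> < 1\<close> is too small to change its sign.
\<close>
lemma perfect_piece_convex:
  fixes g g1 g2 :: "real \<Rightarrow> real"
  assumes g: "\<And>t. t \<in> {a..b} \<Longrightarrow> (g has_real_derivative g1 t) (at t within {a..b})"
    and g1: "\<And>t. t \<in> {a..b} \<Longrightarrow> (g1 has_real_derivative g2 t) (at t within {a..b})"
    and g2: "\<And>t. t \<in> {a..b} \<Longrightarrow> \<bar>g2 t\<bar> \<le> 1" and c: "\<bar>c\<bar> < 1"
    and P: "pderiv (pderiv P) = [:(-1) ^ j:]"
  shows "strictly_below_zero_between (\<lambda>t. (-1) ^ j * (poly P t - c * g t)) a b"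
proof (rule positive_deriv2_below_zero_between)
  fix t assume t: "t \<in> {a..b}"
  have p: "(poly Q has_real_derivative poly (pderiv Q) t) (at t within {a..b})" for Q
    by (rule DERIV_subset[OF poly_DERIV]) simp
  show "((\<lambda>t. (-1) ^ j * (poly P t - c * g t)) has_real_derivative
      (-1) ^ j * (poly (pderiv P) t - c * g1 t)) (at t within {a..b})"
    by (intro DERIV_cmult DERIV_diff p g[OF t])
  show "((\<lambda>t. (-1) ^ j * (poly (pderiv P) t - c * g1 t)) has_real_derivative
      (-1) ^ j * (poly (pderiv (pderiv P)) t - c * g2 t)) (at t within {a..b})"
    by (intro DERIV_cmult DERIV_diff p g1[OF t])
  have "\<bar>(-1) ^ j * (c * g2 t)\<bar> \<le> \<bar>c\<bar> * 1"
    unfolding abs_mult power_abs using g2[OF t] by (simp add: mult_left_le)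
  then have "(-1) ^ j * (c * g2 t) < 1" using c by linarith
  then show "(-1) ^ j * (poly (pderiv (pderiv P)) t - c * g2 t) > 0"
    unfolding P by (simp add: right_diff_distrib flip: power_add mult_2)
qed

lemma card_le_1_if_no_pair:
  fixes Z :: "real set"
  assumes "\<And>x y. x \<in> Z \<Longrightarrow> y \<in> Z \<Longrightarrow> x < y \<Longrightarrow> False"
  shows "card Z \<le> 1"
  using assms
  by (metis card.infinite card_le_Suc0_iff_eq linorder_cases One_nat_def zero_le_one)

lemma card_le_2_if_no_triple:
  fixes Z :: "real set"
  assumes "finite Z"
    and triple: "\<And>x y z. x \<in> Z \<Longrightarrow> y \<in> Z \<Longrightarrow> z \<in> Z \<Longrightarrow> x < y \<Longrightarrow> y < z \<Longrightarrow> False"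
  shows "card Z \<le> 2"
proof (cases "Z = {}")
  case False
  then have M: "Max Z \<in> Z" "\<And>z. z \<in> Z \<Longrightarrow> z \<le> Max Z" using assms(1) by auto
  have "card (Z - {Max Z}) \<le> 1"
    using triple[OF _ _ M(1)] M(2)
    by (intro card_le_1_if_no_pair) (metis DiffE order_less_le singletonI)
  then show ?thesis using M assms(1) by (simp add: card_Diff_singleton)
qed simp

text \<open>
  The right end point belongs to the next piece.  The bound trades a zero against the signs at
  the ends: a convex function with two zeros is positive at both ends.
\<close>
lemma card_zeros_piece:
  fixes w :: "real \<Rightarrow> real"
  assumes w: "strictly_below_zero_between w a b" and "a < b"
    and Z: "finite Z" "Z \<subseteq> {a..<b}" "\<And>z. z \<in> Z \<Longrightarrow> w z = 0"
  shows "card Z \<le> (if w a < 0 then 0 else 1) + (if w b > 0 then 1 else 0)"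
proof -
  have neg: "w y < 0" if "a \<le> x" "x < y" "y < z" "z \<le> b" "w x \<le> 0" "w z \<le> 0" for x y z
    using w that unfolding strictly_below_zero_between_def by blast
  have in_piece: "a \<le> z" "z < b" if "z \<in> Z" for z
    using Z(2) that by auto
  have two: "card Z \<le> 2"
  proof (rule card_le_2_if_no_triple[OF Z(1)])
    fix x y z assume "x \<in> Z" "y \<in> Z" "z \<in> Z" "x < y" "y < z"
    then show False using neg[of x y z] in_piece[of x] in_piece[of z] Z(3) by fastforce
  qed
  have one: "card Z \<le> 1" if "w a < 0 \<or> w b \<le> 0"
  proof (rule card_le_1_if_no_pair)
    fix x y assume *: "x \<in> Z" "y \<in> Z" "x < y"
    from that show False
    proof
      assume "w a < 0"
      moreover from this have "a < x" using in_piece[of x] Z(3)[of x] * by (cases "a = x") auto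
      ultimately show False using neg[of a x y] in_piece[of y] Z(3)[of x] Z(3)[of y] * by simp
    next
      assume "w b \<le> 0"
      then show False
        using neg[of x y b] in_piece[of x] in_piece[of y] Z(3)[of x] Z(3)[of y] * by simp
    qed
  qed
  have none: "card Z \<le> 0" if "w a < 0" "w b \<le> 0"
  proof -
    have False if "x \<in> Z" for x
    proof -
      have "a < x" using \<open>w a < 0\<close> in_piece[of x] Z(3)[of x] that by (cases "a = x") auto
      then show False
        using neg[of a x b] in_piece[of x] Z(3)[of x] that \<open>w a < 0\<close> \<open>w b \<le> 0\<close> by simp
    qed
    then have "Z = {}" by blast
    then show ?thesis by simp
  qed
  show ?thesis using one two none by (auto simp: not_less)
qed

text \<open>
  Each piece has up to two zeros, but by the preceding lemma the second one is available only
  when \<open>(-1)\<^sup>j u\<close> is positive at the right end; then the function that is convex on the next piece,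
  \<open>(-1)\<^bsup>j+1\<^esup> u\<close>, starts negative, and that piece loses a zero.  So the gain does not accumulate.
\<close>
lemma card_zeros_alternately_convex:
  fixes u :: "real \<Rightarrow> real" and \<tau> :: "nat \<Rightarrow> real"
  assumes inc: "\<And>j. j \<le> m \<Longrightarrow> \<tau> j < \<tau> (Suc j)"
    and conv: "\<And>j. j \<le> m \<Longrightarrow>
      strictly_below_zero_between (\<lambda>t. (-1) ^ j * u t) (\<tau> j) (\<tau> (Suc j))"
    and Z: "finite Z" "Z \<subseteq> {\<tau> 0..\<tau> (Suc m)}" "\<And>z. z \<in> Z \<Longrightarrow> u z = 0"
  shows "card Z \<le> m + 2"
proof -
  have piece: "card (Z \<inter> {\<tau> j..<\<tau> (Suc j)}) \<le>
      (if (-1) ^ j * u (\<tau> j) < 0 then 0 else 1) + (if (-1) ^ j * u (\<tau> (Suc j)) > 0 then 1 else 0)"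
    if "j \<le> m" for j
    using card_zeros_piece[OF conv[OF that] inc[OF that], of "Z \<inter> {\<tau> j..<\<tau> (Suc j)}"] Z by simp
  have count: "card (Z \<inter> {\<tau> 0..<\<tau> (Suc j)}) \<le>
      j + 1 + (if (-1) ^ j * u (\<tau> (Suc j)) > 0 then 1 else 0)" if "j \<le> m" for j
    using that
  proof (induction j)
    case 0
    show ?case using piece[of 0] by (simp split: if_splits)
  next
    case (Suc j)
    have "Z \<inter> {\<tau> 0..<\<tau> (Suc (Suc j))} \<subseteq>
        Z \<inter> {\<tau> 0..<\<tau> (Suc j)} \<union> Z \<inter> {\<tau> (Suc j)..<\<tau> (Suc (Suc j))}"
      by auto
    then have "card (Z \<inter> {\<tau> 0..<\<tau> (Suc (Suc j))}) \<le>
        card (Z \<inter> {\<tau> 0..<\<tau> (Suc j)}) + card (Z \<inter> {\<tau> (Suc j)..<\<tau> (Suc (Suc j))})"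
      using Z(1) by (meson card_Un_le card_mono finite_Int finite_UnI order_trans)
    \<comment> \<open>A gain at the right end of one piece is a loss at the left end of the next.\<close>
    moreover have "(-1) ^ Suc j * u (\<tau> (Suc j)) < 0 \<longleftrightarrow> (-1) ^ j * u (\<tau> (Suc j)) > 0"
      by simp
    moreover have "card (Z \<inter> {\<tau> 0..<\<tau> (Suc j)}) \<le>
      j + 1 + (if (-1) ^ j * u (\<tau> (Suc j)) > 0 then 1 else 0)"
      using Suc by simp
    ultimately show ?case using piece[OF Suc.prems] by (simp only: simp_thms split: if_splits)
  qed
  show ?thesis
  proof (cases "\<tau> (Suc m) \<in> Z")
    case True
    have sub: "Z \<subseteq> insert (\<tau> (Suc m)) (Z \<inter> {\<tau> 0..<\<tau> (Suc m)})"
      using Z(2) by force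
    have "card Z \<le> Suc (card (Z \<inter> {\<tau> 0..<\<tau> (Suc m)}))"
      using Z(1) card_mono[OF _ sub] by (simp add: card_insert_if split: if_splits)
    then show ?thesis using count[of m] Z(3)[OF True] by simp
  next
    case False
    then have "Z = Z \<inter> {\<tau> 0..<\<tau> (Suc m)}"
      using Z(2) by (auto simp: order_less_le)
    then show ?thesis using count[of m] by (simp split: if_splits)
  qed
qed

section \<open>Strict sign alternation\<close>

text \<open>
  The count \<open>r\<close> is that of sign changes, one less than the number of points.  Keeping the last point
  \<open>y\<close> and a positive multiple \<open>\<sigma>\<close> of its sign as arguments is what makes alternations extendable to the right.
\<close>
inductive alternates :: "(real \<Rightarrow> real) \<Rightarrow> nat \<Rightarrow> real \<Rightarrow> real \<Rightarrow> bool" for u where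
  start: "0 \<le> x \<Longrightarrow> \<sigma> * u x > 0 \<Longrightarrow> alternates u 0 \<sigma> x"
| step: "alternates u r (- \<sigma>) x \<Longrightarrow> x < y \<Longrightarrow> \<sigma> * u y > 0 \<Longrightarrow> alternates u (Suc r) \<sigma> y"

inductive_cases alternates_SucE: "alternates u (Suc r) \<sigma> y"

lemma alternates_step_neg:
  "alternates u r \<sigma> x \<Longrightarrow> x < y \<Longrightarrow> \<sigma> * u y < 0 \<Longrightarrow> alternates u (Suc r) (- \<sigma>) y"
  using alternates.step[of u r "- \<sigma>" x y] by simp

lemma alternates_last:
  assumes "alternates u r \<sigma> x"
  shows "0 \<le> x" "\<sigma> * u x > 0"
  using assms by (induction rule: alternates.induct) auto

text \<open>
  Between two consecutive points of the alternation the mean value theorem yields a point where the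
  derivative has the sign of the later one.
\<close>
lemma alternates_deriv:
  assumes F: "derivs01 n F" "i < n"
    and "alternates (F i) (Suc r) \<sigma> y" "y \<le> 1"
  shows "\<exists>z<y. alternates (F (Suc i)) r \<sigma> z"
  using assms(3,4)
proof (induction r arbitrary: \<sigma> y)
  case (0 \<sigma> y)
  from 0(1) obtain x where x: "alternates (F i) 0 (- \<sigma>) x" "x < y" "\<sigma> * F i y > 0"
    by (rule alternates_SucE)
  note last = alternates_last[OF x(1)]
  obtain z where z: "x < z" "z < y" "F i y - F i x = (y - x) * F (Suc i) z"
    using mvt_derivs01[OF F last(1) x(2) 0(2)] .
  have "0 < \<sigma> * (F i y - F i x)" using x(3) last(2) by (simp add: algebra_simps)
  then have "0 < (y - x) * (\<sigma> * F (Suc i) z)" unfolding z(3) by (simp add: ac_simps)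
  then have "\<sigma> * F (Suc i) z > 0" using x(2) by (simp add: zero_less_mult_iff)
  then show ?case using z last(1) by (intro exI[of _ z]) (auto intro: alternates.start)
next
  case (Suc r)
  from Suc(2) obtain x where x: "alternates (F i) (Suc r) (- \<sigma>) x" "x < y" "\<sigma> * F i y > 0"
    by (rule alternates_SucE)
  note last = alternates_last[OF x(1)]
  obtain z where z: "x < z" "z < y" "F i y - F i x = (y - x) * F (Suc i) z"
    using mvt_derivs01[OF F last(1) x(2) Suc(3)] .
  have "0 < \<sigma> * (F i y - F i x)" using x(3) last(2) by (simp add: algebra_simps)
  then have "0 < (y - x) * (\<sigma> * F (Suc i) z)" unfolding z(3) by (simp add: ac_simps)
  then have pos: "\<sigma> * F (Suc i) z > 0" using x(2) by (simp add: zero_less_mult_iff)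
  obtain z' where z': "z' < x" "alternates (F (Suc i)) r (- \<sigma>) z'"
    using Suc.IH[OF x(1)] x(2) Suc(3) by auto
  have "z' < z" using z(1) z'(1) by simp
  with z'(2) have "alternates (F (Suc i)) (Suc r) \<sigma> z"
    using pos by (rule alternates.step)
  then show ?case using z(2) by blast
qed

lemma alternates_higher_deriv:
  assumes F: "derivs01 n F" "i + j \<le> n"
    and "alternates (F i) (r + j) \<sigma> y" "y \<le> 1"
  shows "\<exists>z\<le>y. alternates (F (i + j)) r \<sigma> z"
  using assms(2-4)
proof (induction j arbitrary: i y)
  case 0
  then show ?case by auto
next
  case (Suc j)
  then have "i < n" "alternates (F i) (Suc (r + j)) \<sigma> y" by simp_all
  then obtain z where z: "z < y" "alternates (F (Suc i)) (r + j) \<sigma> z"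
    using alternates_deriv[OF F(1) _ _ Suc.prems(3)] by blast
  have "Suc i + j \<le> n" "z \<le> 1" using Suc.prems z by simp_all
  then obtain z' where "z' \<le> z" "alternates (F (Suc i + j)) r \<sigma> z'"
    using Suc.IH[of "Suc i" z] z(2) by blast
  then show ?case using z(1) by (intro exI[of _ z']) simp
qed

text \<open>
  Applied both ways: it excludes three alternating points in an affine piece, and it moves
  the first of two such points to the left end of the piece.
\<close>
lemma affine_no_two_changes:
  fixes w :: "real \<Rightarrow> real"
  assumes w: "\<And>t. t \<in> {v..y} \<Longrightarrow> w t = c + d * t"
    and "v < x" "x < y" "w x < 0" "w y > 0"
  shows "w v < 0"
proof -
  have "w x = c + d * x" "w y = c + d * y" "w v = c + d * v"
    using assms by auto
  moreover from this have "d * (y - x) > 0" using assms by (simp add: algebra_simps)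
  then have "d > 0" using assms by (simp add: zero_less_mult_iff)
  then have "d * v < d * x" using assms by simp
  ultimately show ?thesis using assms by linarith
qed

text \<open>
  A new affine piece contributes at most one sign change: if its last two alternation points both
  lie in the piece, the first of them can be moved back to the knot on the left.
\<close>
lemma alternates_piecewise_affine:
  fixes \<tau> :: "nat \<Rightarrow> real"
  assumes \<tau>0: "\<tau> 0 = 0" and inc: "\<And>j. j \<le> m \<Longrightarrow> \<tau> j < \<tau> (Suc j)"
    and aff: "\<And>j. j \<le> m \<Longrightarrow> \<exists>c d. \<forall>t\<in>{\<tau> j..\<tau> (Suc j)}. u t = c + d * t"
    and "alternates u r \<sigma> y" "j \<le> Suc m" "y \<le> \<tau> j"
  shows "r \<le> j"
  using assms(4-)
proof (induction j arbitrary: r \<sigma> y)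
  case 0
  show ?case
  proof (cases r)
    case (Suc r')
    with 0(1) obtain x where "alternates u r' (- \<sigma>) x" "x < y" by (auto elim: alternates_SucE)
    then show ?thesis using alternates_last(1)[of u r' "- \<sigma>" x] 0 \<tau>0 by simp
  qed simp
next
  case (Suc j)
  obtain c d where cd: "\<And>t. t \<in> {\<tau> j..\<tau> (Suc j)} \<Longrightarrow> u t = c + d * t"
    using aff[of j] Suc.prems by auto
  have aff': "\<sigma> * u v < 0" if "\<tau> j \<le> v" "v < x" "x < y" "\<sigma> * u x < 0" "\<sigma> * u y > 0" for v x
    by (rule affine_no_two_changes[of v y "\<lambda>t. \<sigma> * u t" "\<sigma> * c" "\<sigma> * d" x])
      (use that cd Suc.prems in \<open>auto simp: algebra_simps\<close>)
  show ?case
  proof (cases r)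
    case r: (Suc r')
    with Suc.prems(1) obtain x where x: "alternates u r' (- \<sigma>) x" "x < y" "\<sigma> * u y > 0"
      by (auto elim: alternates_SucE)
    note x_neg = alternates_last(2)[OF x(1)]
    show ?thesis
    proof (cases "x \<le> \<tau> j")
      case True
      then show ?thesis using Suc.IH[OF x(1)] Suc.prems r by simp
    next
      case False
      show ?thesis
      proof (cases r')
        case r': (Suc r'')
        with x(1) obtain v where v: "alternates u r'' \<sigma> v" "v < x"
          by (auto elim: alternates_SucE)
        have "v < \<tau> j"
          using aff'[of v x] x x_neg v alternates_last(2)[OF v(1)] by (force simp: not_less)
        moreover have "\<sigma> * u (\<tau> j) < 0"
          using aff'[of "\<tau> j" x] x x_neg False by simp
        ultimately have "alternates u (Suc r'') (- \<sigma>) (\<tau> j)"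
          using v by (intro alternates.step) auto
        then have "Suc r'' \<le> j"
          using Suc.IH[of "Suc r''" "- \<sigma>" "\<tau> j"] Suc.prems by simp
        then show ?thesis using r r' by simp
      qed (use r in simp)
    qed
  qed simp
qed

section \<open>Polynomials, truncated powers and linear systems\<close>

lemma poly_degree_1: "degree p \<le> 1 \<Longrightarrow> poly p t = coeff p 0 + coeff p 1 * t" for p :: "real poly"
  by (cases "degree p") (auto simp: poly_altdef coeff_eq_0)

lemma higher_pderiv_degree:
  fixes p :: "real poly"
  assumes "degree p \<le> n"
  shows "(pderiv ^^ n) p = [:fact n * coeff p n:]"
proof (rule poly_eqI)
  fix i
  show "coeff ((pderiv ^^ n) p) i = coeff [:fact n * coeff p n:] i"
  proof (cases i)
    case 0
    then show ?thesis by (simp add: coeff_higher_pderiv pochhammer_fact)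
  next
    case (Suc l)
    then have "coeff p (i + n) = 0" using assms by (intro coeff_eq_0) simp
    then show ?thesis using Suc by (simp add: coeff_higher_pderiv)
  qed
qed

lemma alternating_sum: "1 + 2 * (\<Sum>i=1..j. (-1) ^ i) = ((-1) ^ j :: real)"
  by (induction j) simp_all

text \<open>
  At the knot itself the difference quotient is the truncated power
  of the next lower degree, which is continuous there because that degree is positive.
\<close>
lemma truncated_power_deriv:
  "((\<lambda>t::real. max (t - c) 0 ^ Suc (Suc e)) has_real_derivative
     real (Suc (Suc e)) * max (t - c) 0 ^ Suc e) (at t)"
proof (cases t c rule: linorder_cases)
  case less
  have "((\<lambda>_. 0) has_real_derivative 0) (at t)" by simp
  then have "((\<lambda>t. max (t - c) 0 ^ Suc (Suc e)) has_real_derivative 0) (at t)"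
    by (rule has_field_derivative_transform_within_open[where S = "{..<c}"]) (use less in auto)
  then show ?thesis using less by (simp add: max_def)
next
  case equal
  have "max (z - c) 0 ^ Suc (Suc e) = max (z - c) 0 ^ Suc e * (z - c)" for z
    by (simp add: max_def)
  moreover have "isCont (\<lambda>z. max (z - c) 0 ^ Suc e) c"
    by (intro continuous_intros)
  ultimately show ?thesis using equal unfolding CARAT_DERIV
    by (intro exI[of _ "\<lambda>z. max (z - c) 0 ^ Suc e"]) simp
next
  case greater
  have "((\<lambda>t. (t - c) ^ Suc (Suc e)) has_real_derivative real (Suc (Suc e)) * (t - c) ^ Suc e) (at t)"
    by (rule DERIV_cong[OF DERIV_power[where D = 1]]) (auto intro!: derivative_eq_intros)
  then have "((\<lambda>t. max (t - c) 0 ^ Suc (Suc e)) has_real_derivative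
      real (Suc (Suc e)) * (t - c) ^ Suc e) (at t)"
    by (rule has_field_derivative_transform_within_open[where S = "{c<..}"]) (use greater in auto)
  then show ?thesis using greater by (simp add: max_def)
qed

text \<open>
  The derivative of order \<open>i\<close> of \<open>\<lambda>t. max (t - c) 0 ^ d\<close>, meaningful for \<open>i < d\<close>.
\<close>
definition truncated_power :: "nat \<Rightarrow> real \<Rightarrow> nat \<Rightarrow> real \<Rightarrow> real" where
  "truncated_power d c i t = fact d / fact (d - i) * max (t - c) 0 ^ (d - i)"

lemma truncated_power_0: "truncated_power d c 0 t = max (t - c) 0 ^ d"
  by (simp add: truncated_power_def)

lemma derivs01_truncated_power:
  assumes "n < d"
  shows "derivs01 n (truncated_power d c)"
  unfolding derivs01_def
proof (intro conjI allI impI ballI)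
  fix i and t :: real assume "i < n"
  define e where "e = d - i - 2"
  have e: "d - i = Suc (Suc e)" "d - Suc i = Suc e" using assms \<open>i < n\<close> by (auto simp: e_def)
  have *: "fact d / fact (Suc (Suc e)) * (real (Suc (Suc e)) * x) = fact d / fact (Suc e) * x" for x :: real
    by (simp add: fact_Suc[of "Suc e"] del: of_nat_Suc)
  have "(truncated_power d c i has_real_derivative
      fact d / fact (Suc (Suc e)) * (real (Suc (Suc e)) * max (t - c) 0 ^ Suc e)) (at t)"
    unfolding truncated_power_def[abs_def] e by (intro DERIV_cmult truncated_power_deriv)
  then show "(truncated_power d c i has_real_derivative truncated_power d c (Suc i) t)
      (at t within {0..1})"
    unfolding * by (auto simp: truncated_power_def[of d c "Suc i"] e intro: has_field_derivative_at_within)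
next
  show "continuous_on {0..1} (truncated_power d c n)"
    unfolding truncated_power_def[abs_def] by (intro continuous_intros)
qed

text \<open>
  The guard \<open>d > 0\<close> excludes \<open>0 ^ 0 = 1\<close> to the left of the knot.
\<close>
lemma truncated_power_piece:
  fixes c :: real
  assumes "c \<le> a \<or> b \<le> c"
  shows "\<exists>p. degree p \<le> d \<and> (\<forall>t\<in>{a..b}. d > 0 \<longrightarrow> max (t - c) 0 ^ d = poly p t)"
proof (cases "c \<le> a")
  case True
  show ?thesis
  proof (intro exI[of _ "[:- c, 1:] ^ d"] conjI)
    show "degree ([:- c, 1:] ^ d) \<le> d" by (simp add: degree_power_eq)
  qed (use True in auto)
next
  case False
  then show ?thesis using assms by (intro exI[of _ 0]) auto
qed

text \<open>
  The Fredholm alternative for square systems, in a form whose size may depend on a variable.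
\<close>
lemma square_system_solvable:
  fixes a :: "nat \<Rightarrow> nat \<Rightarrow> real"
  assumes "\<And>x. (\<And>i. i < n \<Longrightarrow> (\<Sum>j<n. a i j * x j) = 0) \<Longrightarrow> (\<And>j. j < n \<Longrightarrow> x j = 0)"
  shows "\<exists>x. \<forall>i<n. (\<Sum>j<n. a i j * x j) = b i"
proof -
  define A where "A = mat n n (\<lambda>(i, j). a i j)"
  have A: "A \<in> carrier_mat n n" by (simp add: A_def)
  have prod: "vec_index (A *\<^sub>v v) i = (\<Sum>j<n. a i j * vec_index v j)" if "v \<in> carrier_vec n" "i < n" for v i
    using that by (auto simp: A_def scalar_prod_def lessThan_atLeast0 intro!: sum.cong)
  have "Determinant.det A \<noteq> 0"
  proof
    assume "Determinant.det A = 0"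
    then obtain v where v: "v \<in> carrier_vec n" "v \<noteq> 0\<^sub>v n" "A *\<^sub>v v = 0\<^sub>v n"
      using det_0_iff_vec_prod_zero[OF A] by blast
    have "vec_index v j = 0" if "j < n" for j
      by (rule assms[of "vec_index v", OF _ that]) (use v prod[OF v(1)] in simp)
    then have "v = 0\<^sub>v n" using v(1) by (intro eq_vecI) auto
    with v(2) show False by simp
  qed
  from det_non_zero_imp_unit[OF A this, of "()"]
  obtain B where B: "B \<in> carrier_mat n n" "A * B = 1\<^sub>m n"
    unfolding Units_def ring_mat_def by auto
  have Bb: "B *\<^sub>v vec n b \<in> carrier_vec n" using B by simp
  have "A *\<^sub>v (B *\<^sub>v vec n b) = vec n b"
    using B A by (simp flip: assoc_mult_mat_vec)
  then have "(\<Sum>j<n. a i j * vec_index (B *\<^sub>v vec n b) j) = b i" if "i < n" for i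
    using prod[OF Bb that] that by simp
  then show ?thesis by (intro exI[of _ "vec_index (B *\<^sub>v vec n b)"]) auto
qed

section \<open>Splines with fixed knots\<close>

locale knots =
  fixes m :: nat and \<tau> :: "nat \<Rightarrow> real"
  assumes tau_0: "\<tau> 0 = 0" and tau_1: "\<tau> (Suc m) = 1"
    and tau_Suc: "j \<le> m \<Longrightarrow> \<tau> j < \<tau> (Suc j)"
begin

lemma tau_less: "i < j \<Longrightarrow> j \<le> Suc m \<Longrightarrow> \<tau> i < \<tau> j"
proof (induction j)
  case (Suc j)
  then show ?case using tau_Suc[of j] by (cases "i = j") auto
qed simp

lemma tau_le: "i \<le> j \<Longrightarrow> j \<le> Suc m \<Longrightarrow> \<tau> i \<le> \<tau> j"
  using tau_less[of i j] by (cases "i = j") auto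

lemma tau_in: "i \<le> Suc m \<Longrightarrow> 0 \<le> \<tau> i" "i \<le> Suc m \<Longrightarrow> \<tau> i \<le> 1"
  using tau_le[of 0 i] tau_le[of i "Suc m"] tau_0 tau_1 by auto

lemma in_some_piece:
  assumes "t \<in> {0..1}"
  obtains j where "j \<le> m" "t \<in> {\<tau> j..\<tau> (Suc j)}"
proof -
  have "\<exists>j\<le>i. t \<in> {\<tau> j..\<tau> (Suc j)}" if "t \<le> \<tau> (Suc i)" for i
    using that
  proof (induction i)
    case 0
    then show ?case using assms tau_0 by auto
  next
    case (Suc i)
    then show ?case by (cases "t \<le> \<tau> (Suc i)") (auto intro: le_SucI)
  qed
  from this[of m] show ?thesis using that assms tau_1 by auto
qed

definition spline_derivs :: "(nat \<Rightarrow> real \<Rightarrow> real) \<Rightarrow> bool" where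
  "spline_derivs F \<longleftrightarrow> derivs01 (m + 2) F \<and>
     (\<forall>j\<le>m. \<exists>p. degree p \<le> m + 3 \<and> (\<forall>t\<in>{\<tau> j..\<tau> (Suc j)}. F 0 t = poly p t))"

lemma spline_derivs_diff:
  assumes "spline_derivs F" "spline_derivs G"
  shows "spline_derivs (\<lambda>i t. F i t - G i t)"
  unfolding spline_derivs_def
proof (intro conjI allI impI)
  show "derivs01 (m + 2) (\<lambda>i t. F i t - G i t)"
    using assms by (intro derivs01_diff) (auto simp: spline_derivs_def)
  fix j assume "j \<le> m"
  with assms obtain p q where "degree p \<le> m + 3" "\<forall>t\<in>{\<tau> j..\<tau> (Suc j)}. F 0 t = poly p t"
    "degree q \<le> m + 3" "\<forall>t\<in>{\<tau> j..\<tau> (Suc j)}. G 0 t = poly q t"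
    unfolding spline_derivs_def by meson
  then show "\<exists>p. degree p \<le> m + 3 \<and> (\<forall>t\<in>{\<tau> j..\<tau> (Suc j)}. F 0 t - G 0 t = poly p t)"
    by (intro exI[of _ "p - q"]) (auto intro: degree_diff_le)
qed

lemma spline_derivs_sum:
  assumes "finite A" "\<And>a. a \<in> A \<Longrightarrow> spline_derivs (F a)"
  shows "spline_derivs (\<lambda>i t. \<Sum>a\<in>A. x a * F a i t)"
  unfolding spline_derivs_def
proof (intro conjI allI impI)
  show "derivs01 (m + 2) (\<lambda>i t. \<Sum>a\<in>A. x a * F a i t)"
    using assms by (intro derivs01_sum derivs01_cmult) (auto simp: spline_derivs_def)
  fix j assume "j \<le> m"
  with assms(2) have "\<forall>a\<in>A. \<exists>p. degree p \<le> m + 3 \<and> (\<forall>t\<in>{\<tau> j..\<tau> (Suc j)}. F a 0 t = poly p t)"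
    unfolding spline_derivs_def by blast
  then obtain p where "\<forall>a\<in>A. degree (p a) \<le> m + 3 \<and> (\<forall>t\<in>{\<tau> j..\<tau> (Suc j)}. F a 0 t = poly (p a) t)"
    by (rule bchoice[THEN exE])
  then show "\<exists>p. degree p \<le> m + 3 \<and> (\<forall>t\<in>{\<tau> j..\<tau> (Suc j)}. (\<Sum>a\<in>A. x a * F a 0 t) = poly p t)"
    using assms(1)
    by (intro exI[of _ "\<Sum>a\<in>A. Polynomial.smult (x a) (p a)"] conjI)
      (auto simp: poly_sum intro!: degree_sum_le order_trans[OF degree_smult_le])
qed

lemma splines01_spline_derivs:
  assumes "s \<in> splines01 (m + 3) m \<tau>"
  shows "spline_derivs (\<lambda>i. (deriv01 ^^ i) s)"
proof -
  have "m + 3 - 1 = m + 2" by simp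
  with assms have "s \<in> C_class01 (m + 2)"
    "\<forall>j\<le>m. \<exists>p. degree p \<le> m + 3 \<and> (\<forall>t\<in>{\<tau> j..\<tau> (Suc j)}. s t = poly p t)"
    unfolding splines01_def by auto
  then show ?thesis
    unfolding spline_derivs_def using C_class01_derivs01 by simp
qed

lemma spline_derivs_splines01:
  assumes "spline_derivs F" "\<And>t. t \<in> {0..1} \<Longrightarrow> s t = F 0 t"
  shows "s \<in> splines01 (m + 3) m \<tau>"
proof -
  have "s \<in> C_class01 (m + 2)"
    using assms by (intro derivs01_C_class01[of _ F]) (auto simp: spline_derivs_def)
  moreover have "\<exists>p. degree p \<le> m + 3 \<and> (\<forall>t\<in>{\<tau> j..\<tau> (Suc j)}. s t = poly p t)" if "j \<le> m" for j
  proof -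
    have "{\<tau> j..\<tau> (Suc j)} \<subseteq> {0..1}" using tau_in[of j] tau_in[of "Suc j"] that by auto
    moreover from assms(1) that
    obtain p where p: "degree p \<le> m + 3" "\<forall>t\<in>{\<tau> j..\<tau> (Suc j)}. F 0 t = poly p t"
      unfolding spline_derivs_def by meson
    ultimately have "s t = poly p t" if "t \<in> {\<tau> j..\<tau> (Suc j)}" for t
      using assms(2)[of t] bspec[OF p(2) that] that by (metis subsetD)
    with p(1) show ?thesis by blast
  qed
  moreover have "m + 3 - 1 = m + 2" by simp
  ultimately show ?thesis unfolding splines01_def by simp
qed

end

section \<open>Uniqueness of Hermite interpolation\<close>

text \<open>
  Here \<open>c\<close> is the end point where all derivatives vanish, and the value also vanishes at the
  other end.  Rolle's theorem, always between \<open>c\<close> and the last zero found, gives a zero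
  of the affine top derivative that differs from \<open>c\<close>.  So the top derivative is identically zero, and
  integrating down from \<open>c\<close> the lower ones are too.
\<close>
lemma piece_vanishes:
  assumes F: "derivs01 (Suc N) F" and ab: "0 \<le> a" "a < b" "b \<le> 1"
    and aff: "\<And>t. t \<in> {a..b} \<Longrightarrow> F (Suc N) t = c0 + c1 * t"
    and c: "c \<in> {a, b}" "\<And>i. i \<le> Suc N \<Longrightarrow> F i c = 0"
    and ends: "F 0 a = 0" "F 0 b = 0"
    and t: "t \<in> {a..b}"
  shows "F 0 t = 0"
proof -
  \<comment> \<open>The other end of the interval.\<close>
  define e where "e = a + b - c"
  have e: "e \<in> {a, b}" "e \<noteq> c" using c ab by (auto simp: e_def)
  have "\<exists>z\<in>{a..b}. z \<noteq> c \<and> F i z = 0" if "i \<le> Suc N" for i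
    using that
  proof (induction i)
    case 0
    then show ?case using ends e ab by (intro bexI[of _ e]) auto
  next
    case (Suc i)
    then obtain z where z: "z \<in> {a..b}" "z \<noteq> c" "F i z = 0" by auto
    have "F i c = 0" using c Suc by simp
    have "i < Suc N" using Suc by simp
    define x y where "x = min z c" and "y = max z c"
    have xy: "0 \<le> x" "x < y" "y \<le> 1" "F i x = 0" "F i y = 0" "a \<le> x" "y \<le> b"
      using z c ab \<open>F i c = 0\<close> unfolding x_def y_def by (auto simp: min_def max_def)
    obtain w where w: "x < w" "w < y" "F i y - F i x = (y - x) * F (Suc i) w"
      using mvt_derivs01[OF F \<open>i < Suc N\<close> xy(1-3)] .
    have "F (Suc i) w = 0" using w xy by simp
    moreover have "w \<noteq> c" using w c z unfolding x_def y_def by auto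
    ultimately show ?case using w xy by (intro bexI[of _ w]) auto
  qed
  from this[of "Suc N"] obtain z where z: "z \<in> {a..b}" "z \<noteq> c" "F (Suc N) z = 0" by auto
  have cin: "c \<in> {a..b}" using c(1) ab by auto
  have eqs: "c0 + c1 * z = 0" "c0 + c1 * c = 0"
    using aff[OF z(1)] aff[OF cin] z c(2)[of "Suc N"] by simp_all
  then have "c1 * (z - c) = 0" unfolding right_diff_distrib by linarith
  then have "c1 = 0" "c0 = 0" using z eqs by auto
  then have top: "F (Suc N) t = 0" if "t \<in> {a..b}" for t using aff[OF that] by simp
  have "\<forall>t\<in>{a..b}. F (Suc N - j) t = 0" if "j \<le> Suc N" for j
    using that
  proof (induction j)
    case 0
    then show ?case using top by simp
  next
    case (Suc j)
    define i where "i = Suc N - Suc j"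
    have i: "Suc N - j = Suc i" "i < Suc N" using Suc by (auto simp: i_def)
    have zero: "\<forall>t\<in>{a..b}. F (Suc i) t = 0" using Suc i by simp
    have "F i c = 0" using c i by simp
    have "F i t = 0" if t: "t \<in> {a..b}" for t
    proof (cases "t = c")
      case False
      define x y where "x = min t c" and "y = max t c"
      have xy: "0 \<le> x" "x < y" "y \<le> 1" "a \<le> x" "y \<le> b"
        using t cin ab False unfolding x_def y_def by (auto simp: min_def max_def)
      obtain w where w: "x < w" "w < y" "F i y - F i x = (y - x) * F (Suc i) w"
        using mvt_derivs01[OF F i(2) xy(1-3)] .
      have "F (Suc i) w = 0" using w xy zero by auto
      then have "F i y = F i x" using w by simp
      then show ?thesis using \<open>F i c = 0\<close> unfolding x_def y_def by (auto simp: min_def max_def split: if_splits)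
    qed (use \<open>F i c = 0\<close> in simp)
    then show ?case by (simp add: i_def)
  qed
  from this[of "Suc N"] t show ?thesis by simp
qed

text \<open>
  The first derivative vanishes at both ends and takes the sign of \<open>\<sigma>\<close> and then the opposite one
  in between, so its derivative alternates at three points.
\<close>
lemma piece_sign_changes:
  assumes F: "derivs01 n F" "n \<ge> 2" and ab: "0 \<le> a" "b \<le> 1"
    and zero: "F 0 a = 0" "F 0 b = 0" "F 1 a = 0" "F 1 b = 0"
    and x: "a < x" "x < b" "\<sigma> * F 0 x > 0"
  obtains p q r where "a < p" "p < q" "q < r" "r < b"
    "\<sigma> * F 2 p > 0" "\<sigma> * F 2 q < 0" "\<sigma> * F 2 r > 0"
proof -
  note two = numeral_2_eq_2
  have pos: "\<sigma> * D > 0" if "\<sigma> * (h * D) > 0" "h > 0" for h D :: real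
    using that by (metis mult.left_commute zero_less_mult_pos)
  have neg: "\<sigma> * D < 0" if "\<sigma> * (h * D) < 0" "h > 0" for h D :: real
    using pos[of h "- D"] that by simp
  obtain y where y: "a < y" "y < x" "F 0 x - F 0 a = (x - a) * F 1 y"
    using mvt_derivs01[of n F 0 a x] F ab x by auto
  have "\<sigma> * ((x - a) * F 1 y) > 0" using x zero unfolding y(3)[symmetric] by simp
  then have y': "\<sigma> * F 1 y > 0" by (rule pos) (use x in simp)
  obtain z where z: "x < z" "z < b" "F 0 b - F 0 x = (b - x) * F 1 z"
    using mvt_derivs01[of n F 0 x b] F ab x by auto
  have "\<sigma> * ((b - x) * F 1 z) < 0" using x zero unfolding z(3)[symmetric] by simp
  then have z': "\<sigma> * F 1 z < 0" by (rule neg) (use x in simp)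
  obtain p where p: "a < p" "p < y" "F 1 y - F 1 a = (y - a) * F 2 p"
    using mvt_derivs01[of n F 1 a y] F ab x y by (auto simp: two)
  obtain q where q: "y < q" "q < z" "F 1 z - F 1 y = (z - y) * F 2 q"
    using mvt_derivs01[of n F 1 y z] F ab x y z by (auto simp: two)
  obtain r where r: "z < r" "r < b" "F 1 b - F 1 z = (b - z) * F 2 r"
    using mvt_derivs01[of n F 1 z b] F ab x z by (auto simp: two)
  have "\<sigma> * ((y - a) * F 2 p) > 0" using y' zero unfolding p(3)[symmetric] by simp
  then have "\<sigma> * F 2 p > 0" by (rule pos) (use y in simp)
  moreover have "\<sigma> * ((z - y) * F 2 q) < 0"
    using y' z' unfolding q(3)[symmetric] by (simp add: right_diff_distrib)
  then have "\<sigma> * F 2 q < 0" by (rule neg) (use y z in simp)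
  moreover have "\<sigma> * ((b - z) * F 2 r) > 0" using z' zero unfolding r(3)[symmetric] by simp
  then have "\<sigma> * F 2 r > 0" by (rule pos) (use z in simp)
  ultimately show ?thesis
    using p(1,2) q(1,2) r(1,2) by (intro that[of p q r]) simp_all
qed

context knots
begin

lemma spline_derivs_affine:
  assumes F: "spline_derivs F" and "j \<le> m"
  shows "\<exists>c d. \<forall>t\<in>{\<tau> j..\<tau> (Suc j)}. F (m + 2) t = c + d * t"
proof -
  have der: "derivs01 (m + 2) F" using F by (simp add: spline_derivs_def)
  from assms obtain p where p: "degree p \<le> m + 3"
    "\<forall>t\<in>{\<tau> j..\<tau> (Suc j)}. F 0 t = poly p t"
    unfolding spline_derivs_def by meson
  let ?q = "(pderiv ^^ (m + 2)) p"
  have "degree ?q \<le> 1" using p(1) unfolding degree_higher_pderiv by simp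
  moreover have "F (m + 2) t = poly ?q t" if "t \<in> {\<tau> j..\<tau> (Suc j)}" for t
    using derivs01_piece_poly[OF der _ _ _ _ _ that, of p "m + 2"] p(2) \<open>j \<le> m\<close>
      tau_in[of j] tau_in[of "Suc j"] tau_Suc[of j] by simp
  ultimately show ?thesis using poly_degree_1 by metis
qed

lemma spline_zero_on_neighbours:
  assumes F: "spline_derivs F"
    and zero: "\<And>i. i \<le> Suc m \<Longrightarrow> F 0 (\<tau> i) = 0"
    and j: "j \<le> m" "\<And>t. t \<in> {\<tau> j..\<tau> (Suc j)} \<Longrightarrow> F 0 t = 0"
    and l: "l \<le> m" "l = Suc j \<or> j = Suc l" and t: "t \<in> {\<tau> l..\<tau> (Suc l)}"
  shows "F 0 t = 0"
proof -
  have der: "derivs01 (m + 2) F" using F by (simp add: spline_derivs_def)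
  have vanish: "F i t = 0" if "i \<le> m + 2" "t \<in> {\<tau> j..\<tau> (Suc j)}" for i t
    using derivs01_piece_poly[OF der _ _ _ _ that, of 0] j tau_in[of j] tau_in[of "Suc j"]
      tau_Suc[of j] by simp
  obtain c d where cd: "\<forall>t\<in>{\<tau> l..\<tau> (Suc l)}. F (m + 2) t = c + d * t"
    using spline_derivs_affine[OF F l(1)] by blast
  define e where "e = (if l = Suc j then \<tau> l else \<tau> (Suc l))"
  have der': "derivs01 (Suc (m + 1)) F" using der by simp
  have aff: "F (Suc (m + 1)) t = c + d * t" if "t \<in> {\<tau> l..\<tau> (Suc l)}" for t
    using cd that by simp
  have e: "e \<in> {\<tau> l, \<tau> (Suc l)}" "e \<in> {\<tau> j..\<tau> (Suc j)}"
    using l(2) tau_Suc[OF j(1)] by (auto simp: e_def)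
  have "F i e = 0" if "i \<le> Suc (m + 1)" for i
    using vanish[OF _ e(2), of i] that by simp
  moreover have "0 \<le> \<tau> l" "\<tau> l < \<tau> (Suc l)" "\<tau> (Suc l) \<le> 1" "F 0 (\<tau> l) = 0" "F 0 (\<tau> (Suc l)) = 0"
    using tau_in[of l] tau_in[of "Suc l"] tau_Suc[of l] zero l(1) by simp_all
  ultimately show ?thesis
    using piece_vanishes[OF der' _ _ _ aff e(1) _ _ _ t] by blast
qed

lemma spline_zero_everywhere:
  assumes F: "spline_derivs F"
    and zero: "\<And>i. i \<le> Suc m \<Longrightarrow> F 0 (\<tau> i) = 0"
    and j: "j \<le> m" "\<And>t. t \<in> {\<tau> j..\<tau> (Suc j)} \<Longrightarrow> F 0 t = 0"
    and t: "t \<in> {0..1}"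
  shows "F 0 t = 0"
proof -
  define Z where "Z l \<longleftrightarrow> (\<forall>t\<in>{\<tau> l..\<tau> (Suc l)}. F 0 t = 0)" for l
  have step: "Z l" if "a \<le> m" "Z a" "l \<le> m" "l = Suc a \<or> a = Suc l" for a l
    using spline_zero_on_neighbours[OF F zero that(1) _ that(3,4)] that(2)
    unfolding Z_def by blast
  have Zj: "Z j" using j(2) unfolding Z_def by blast
  have up: "Z (j + i)" if "j + i \<le> m" for i
    using that
  proof (induction i)
    case (Suc i)
    then show ?case using step[of "j + i" "j + Suc i"] by simp
  qed (use Zj in simp)
  have down: "Z (j - i)" if "i \<le> j" for i
    using that
  proof (induction i)
    case (Suc i)
    then have "Z (j - i)" "j - i \<le> m" "j - Suc i \<le> m" "j - i = Suc (j - Suc i)"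
      using j(1) by simp_all
    then show ?case using step by blast
  qed (use Zj in simp)
  obtain l where l: "l \<le> m" "t \<in> {\<tau> l..\<tau> (Suc l)}" using in_some_piece[OF t] .
  have "Z l" using up[of "l - j"] down[of "j - l"] l(1) by (cases "j \<le> l") simp_all
  then show ?thesis using l(2) unfolding Z_def by blast
qed

text \<open>
  Each piece yields three alternating points of the second derivative.  A new piece therefore adds at least two sign
  changes: if its first sign agrees with the last one so far, its second and third points extend
  the alternation, otherwise its first and second do.
\<close>
lemma spline_hermite_unique:
  assumes F: "spline_derivs F"
    and zero: "\<And>i. i \<le> Suc m \<Longrightarrow> F 0 (\<tau> i) = 0" "\<And>i. i \<le> Suc m \<Longrightarrow> F 1 (\<tau> i) = 0"
    and t: "t \<in> {0..1}"
  shows "F 0 t = 0"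
proof (rule ccontr)
  assume nz: "F 0 t \<noteq> 0"
  have der: "derivs01 (m + 2) F" using F by (simp add: spline_derivs_def)
  have ex: "\<exists>x\<in>{\<tau> j..\<tau> (Suc j)}. F 0 x \<noteq> 0" if "j \<le> m" for j
    using spline_zero_everywhere[OF F zero(1) that _ t] nz by blast
  have piece: "\<exists>p q r \<sigma>. \<tau> j < p \<and> p < q \<and> q < r \<and> r < \<tau> (Suc j) \<and> \<bar>\<sigma>\<bar> = 1 \<and>
      \<sigma> * F 2 p > 0 \<and> \<sigma> * F 2 q < 0 \<and> \<sigma> * F 2 r > 0" if jm: "j \<le> m" for j
  proof -
    obtain x where x: "x \<in> {\<tau> j..\<tau> (Suc j)}" "F 0 x \<noteq> 0" using ex[OF jm] by blast
    then have "x \<noteq> \<tau> j" "x \<noteq> \<tau> (Suc j)" using zero jm by auto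
    with x have x': "\<tau> j < x" "x < \<tau> (Suc j)" by auto
    have "sgn (F 0 x) * F 0 x > 0" using x by (simp add: sgn_if)
    with x' obtain p q r where "\<tau> j < p" "p < q" "q < r" "r < \<tau> (Suc j)"
      "sgn (F 0 x) * F 2 p > 0" "sgn (F 0 x) * F 2 q < 0" "sgn (F 0 x) * F 2 r > 0"
      using piece_sign_changes[OF der, of "\<tau> j" "\<tau> (Suc j)" x "sgn (F 0 x)"]
        zero[of j] zero[of "Suc j"] tau_in[of j] tau_in[of "Suc j"] jm by auto
    moreover have "\<bar>sgn (F 0 x)\<bar> = 1" using x by (simp add: sgn_if)
    ultimately show ?thesis by blast
  qed
  have many: "\<exists>\<sigma> y. \<bar>\<sigma>\<bar> = 1 \<and> alternates (F 2) (2 * j + 2) \<sigma> y \<and> y < \<tau> (Suc j)" if "j \<le> m" for j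
    using that
  proof (induction j)
    case 0
    obtain p q r \<sigma> where *: "\<tau> 0 < p" "p < q" "q < r" "r < \<tau> (Suc 0)" "\<bar>\<sigma>\<bar> = 1"
      "\<sigma> * F 2 p > 0" "\<sigma> * F 2 q < 0" "\<sigma> * F 2 r > 0"
      using piece[of 0] by auto
    have "alternates (F 2) 0 \<sigma> p" using * tau_0 by (intro alternates.start) auto
    then have "alternates (F 2) (Suc 0) (- \<sigma>) q" by (rule alternates_step_neg) (use * in simp_all)
    then have "alternates (F 2) (Suc (Suc 0)) \<sigma> r" by (rule alternates.step) (use * in simp_all)
    then have "alternates (F 2) (2 * 0 + 2) \<sigma> r" by (simp add: numeral_2_eq_2)
    then show ?case using * by blast
  next
    case (Suc j)
    then obtain \<rho> y where y: "\<bar>\<rho>\<bar> = 1" "alternates (F 2) (2 * j + 2) \<rho> y" "y < \<tau> (Suc j)"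
      by auto
    obtain p q r \<sigma> where *: "\<tau> (Suc j) < p" "p < q" "q < r" "r < \<tau> (Suc (Suc j))" "\<bar>\<sigma>\<bar> = 1"
      "\<sigma> * F 2 p > 0" "\<sigma> * F 2 q < 0" "\<sigma> * F 2 r > 0"
      using piece[of "Suc j"] Suc by auto
    have idx: "2 * Suc j + 2 = Suc (Suc (2 * j + 2))" by simp
    have "\<sigma> = \<rho> \<or> \<sigma> = - \<rho>" using y(1) *(5) by (auto simp: abs_if split: if_splits)
    then show ?case
    proof
      assume "\<sigma> = \<rho>"
      with y(2) have "alternates (F 2) (2 * j + 2) \<sigma> y" by simp
      then have "alternates (F 2) (Suc (2 * j + 2)) (- \<sigma>) q"
        by (rule alternates_step_neg) (use y * in simp_all)
      then have "alternates (F 2) (Suc (Suc (2 * j + 2))) \<sigma> r"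
        by (rule alternates.step) (use * in simp_all)
      then show ?thesis unfolding idx using * by blast
    next
      assume "\<sigma> = - \<rho>"
      with y(2) have "alternates (F 2) (2 * j + 2) (- \<sigma>) y" by simp
      then have "alternates (F 2) (Suc (2 * j + 2)) \<sigma> p"
        by (rule alternates.step) (use y * in simp_all)
      then have "alternates (F 2) (Suc (Suc (2 * j + 2))) (- \<sigma>) q"
        by (rule alternates_step_neg) (use * in simp_all)
      moreover have "\<bar>- \<sigma>\<bar> = 1" "q < \<tau> (Suc (Suc j))" using * by auto
      ultimately show ?thesis unfolding idx by blast
    qed
  qed
  obtain \<sigma> y where y: "alternates (F 2) (2 * m + 2) \<sigma> y" "y < 1"
    using many[of m] tau_1 by auto
  have "alternates (F 2) (m + 2 + m) \<sigma> y" using y(1) by (simp add: mult_2 add.commute add.left_commute)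
  then obtain z where z: "z \<le> y" "alternates (F (2 + m)) (m + 2) \<sigma> z"
    using alternates_higher_deriv[OF der, of 2 m "m + 2" \<sigma> y] y(2) by auto
  have "m + 2 \<le> Suc m"
  proof (rule alternates_piecewise_affine[OF tau_0 tau_Suc _ z(2)])
    show "\<exists>c d. \<forall>t\<in>{\<tau> j..\<tau> (Suc j)}. F (2 + m) t = c + d * t" if "j \<le> m" for j
      using spline_derivs_affine[OF F that] by (simp add: add.commute)
  qed (use z y tau_1 in auto)
  then show False by simp
qed

section \<open>Existence of the Hermite interpolant\<close>

text \<open>
  The monomials up to degree \<open>m + 3\<close>, followed by the truncated powers at \<open>\<tau> 1, \<dots>, \<tau> m\<close>: the
  index \<open>m + 3 + j\<close> belongs to the knot \<open>\<tau> j\<close>.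
\<close>
definition basis :: "nat \<Rightarrow> nat \<Rightarrow> real \<Rightarrow> real" where
  "basis l = (if l < m + 4 then (\<lambda>i. poly ((pderiv ^^ i) (Polynomial.monom 1 l)))
     else truncated_power (m + 3) (\<tau> (l - (m + 3))))"

lemma basis_0:
  "l < m + 4 \<Longrightarrow> basis l 0 t = t ^ l"
  "\<not> l < m + 4 \<Longrightarrow> basis l 0 t = max (t - \<tau> (l - (m + 3))) 0 ^ (m + 3)"
  by (simp_all add: basis_def poly_monom truncated_power_0)

lemma spline_derivs_basis:
  assumes "l < 2 * m + 4"
  shows "spline_derivs (basis l)"
  unfolding spline_derivs_def
proof (intro conjI allI impI)
  show "derivs01 (m + 2) (basis l)"
    unfolding basis_def by (simp add: derivs01_poly derivs01_truncated_power)
  fix j assume j: "j \<le> m"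
  show "\<exists>p. degree p \<le> m + 3 \<and> (\<forall>t\<in>{\<tau> j..\<tau> (Suc j)}. basis l 0 t = poly p t)"
  proof (cases "l < m + 4")
    case True
    have "degree (Polynomial.monom (1 :: real) l) \<le> m + 3"
      using True by (simp add: degree_monom_eq)
    then show ?thesis
      using True by (intro exI[of _ "Polynomial.monom 1 l"]) (simp add: basis_0 poly_monom)
  next
    case False
    define i where "i = l - (m + 3)"
    have "i \<le> m" using assms by (simp add: i_def)
    then have "\<tau> i \<le> \<tau> j \<or> \<tau> (Suc j) \<le> \<tau> i"
      using tau_le[of i j] tau_le[of "Suc j" i] j by (cases "i \<le> j") simp_all
    from truncated_power_piece[OF this, of "m + 3"] show ?thesis
      using False by (simp add: basis_0 i_def)
  qed
qed

text \<open>
  On the first piece all truncated powers vanish, so the monomials have zero coefficients.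
  Evaluation at \<open>\<tau> (j + 1)\<close> then isolates the coefficient of the truncated power at \<open>\<tau> j\<close>, because
  those at later knots vanish there.
\<close>
lemma basis_independent:
  assumes zero: "\<And>t. t \<in> {0..1} \<Longrightarrow> (\<Sum>l<2*m+4. x l * basis l 0 t) = 0"
    and l: "l < 2 * m + 4"
  shows "x l = 0"
proof -
  have low: "x l = 0" if "l < m + 4" for l
  proof -
    define p where "p = (\<Sum>l<m+4. Polynomial.monom (x l) l)"
    have p0: "poly p t = 0" if t: "t \<in> {\<tau> 0..\<tau> 1}" for t
    proof -
      have t01: "t \<in> {0..1}" using t tau_0 tau_in[of 1] by simp
      have "basis l 0 t = 0" if "l \<in> {..<2*m+4} - {..<m+4}" for l
      proof -
        have "\<tau> 1 \<le> \<tau> (l - (m + 3))" using that by (intro tau_le) auto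
        then show ?thesis using that t by (simp add: basis_0)
      qed
      then have "(\<Sum>l<m+4. x l * basis l 0 t) = (\<Sum>l<2*m+4. x l * basis l 0 t)"
        by (intro sum.mono_neutral_left) auto
      then show ?thesis using zero[OF t01]
        by (simp add: p_def poly_sum poly_monom basis_0)
    qed
    have "p = 0"
    proof (rule ccontr)
      assume "p \<noteq> 0"
      then have "finite {t. poly p t = 0}" by (rule poly_roots_finite)
      moreover have "{\<tau> 0..\<tau> 1} \<subseteq> {t. poly p t = 0}" using p0 by blast
      ultimately have "finite {\<tau> 0..\<tau> 1}" by (rule rev_finite_subset)
      then show False using infinite_Icc[of "\<tau> 0" "\<tau> 1"] tau_Suc[of 0] by simp
    qed
    moreover have "coeff p l = x l"
      using that by (simp add: p_def coeff_sum)
    ultimately show ?thesis by simp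
  qed
  have high: "x (m + 3 + j) = 0" if "1 \<le> j" "j \<le> m" for j
    using that
  proof (induction j rule: less_induct)
    case (less j)
    define t where "t = \<tau> (Suc j)"
    have t01: "t \<in> {0..1}" using tau_in[of "Suc j"] less by (simp add: t_def)
    have "x l * basis l 0 t = (if l = m + 3 + j then x l * (t - \<tau> j) ^ (m + 3) else 0)"
      if "l < 2 * m + 4" for l
    proof (cases "l < m + 4")
      case True
      then show ?thesis using low[OF True] less by simp
    next
      case False
      define i where "i = l - (m + 3)"
      have i: "l = m + 3 + i" "1 \<le> i" "i \<le> m" using False that by (auto simp: i_def)
      consider "i < j" | "i = j" | "Suc j \<le> i" by linarith
      then show ?thesis
      proof cases
        case 1
        then show ?thesis using less.IH[of i] i by simp
      next
        case 2
        then show ?thesis using False i tau_Suc[of j] by (simp add: basis_0 t_def)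
      next
        case 3
        then show ?thesis using False i tau_le[of "Suc j" i] by (simp add: basis_0 t_def)
      qed
    qed
    then have "(\<Sum>l<2*m+4. x l * basis l 0 t) =
        (\<Sum>l<2*m+4. if l = m + 3 + j then x l * (t - \<tau> j) ^ (m + 3) else 0)"
      by (intro sum.cong) simp_all
    also have "\<dots> = x (m + 3 + j) * (t - \<tau> j) ^ (m + 3)"
      using less by (subst sum.delta) simp_all
    finally have "x (m + 3 + j) * (t - \<tau> j) ^ (m + 3) = 0" using zero[OF t01] by simp
    then show ?case using tau_Suc[of j] less by (simp add: t_def)
  qed
  show ?thesis
  proof (cases "l < m + 4")
    case False
    then show ?thesis using high[of "l - (m + 3)"] l by simp
  qed (use low in simp)
qed

lemma spline_hermite_exists:
  "\<exists>F. spline_derivs F \<and> (\<forall>i\<le>Suc m. F 0 (\<tau> i) = y i \<and> F 1 (\<tau> i) = y' i)"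
proof -
  define n where "n = 2 * m + 4"
  define a where "a e l = (if e \<le> Suc m then basis l 0 (\<tau> e) else basis l 1 (\<tau> (e - (m + 2))))" for e l
  define b where "b e = (if e \<le> Suc m then y e else y' (e - (m + 2)))" for e
  define F where "F x i t = (\<Sum>l<n. x l * basis l i t)" for x i t
  have F: "spline_derivs (F x)" for x
    unfolding F_def[abs_def] using spline_derivs_basis by (intro spline_derivs_sum) (auto simp: n_def)
  have row: "F x 0 (\<tau> i) = (\<Sum>l<n. a i l * x l)" "F x 1 (\<tau> i) = (\<Sum>l<n. a (m + 2 + i) l * x l)"
    if "i \<le> Suc m" for x i
    using that by (simp_all add: F_def a_def mult.commute)
  have idx: "i < n" "m + 2 + i < n" if "i \<le> Suc m" for i
    using that by (simp_all add: n_def)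
  have "\<exists>x. \<forall>e<n. (\<Sum>l<n. a e l * x l) = b e"
  proof (rule square_system_solvable)
    fix x l assume hom: "\<And>e. e < n \<Longrightarrow> (\<Sum>l<n. a e l * x l) = 0" and l: "l < n"
    have "F x 0 t = 0" if "t \<in> {0..1}" for t
      using F _ _ that by (rule spline_hermite_unique) (use row hom idx in simp_all)
    then show "x l = 0"
      using basis_independent[of x l] l by (simp add: F_def n_def)
  qed
  then obtain x where x: "\<And>e. e < n \<Longrightarrow> (\<Sum>l<n. a e l * x l) = b e" by blast
  have "F x 0 (\<tau> i) = y i \<and> F x 1 (\<tau> i) = y' i" if "i \<le> Suc m" for i
    using row[OF that, of x] x[of i] x[of "m + 2 + i"] idx[OF that] that by (simp add: b_def)
  then show ?thesis using F[of x] by blast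
qed

text \<open>
  Turns the definite description into an interpolant that can be differentiated.
\<close>
lemma hermite_spline_derivs:
  assumes k: "2 * k = m + 4"
  obtains H where "spline_derivs H"
    "\<And>t. t \<in> {0..1} \<Longrightarrow> hermite_spline k \<tau> f t = H 0 t"
    "\<And>i. i \<le> Suc m \<Longrightarrow> H 0 (\<tau> i) = f (\<tau> i)"
    "\<And>i. i \<le> Suc m \<Longrightarrow> H 1 (\<tau> i) = deriv01 f (\<tau> i)"
proof -
  have k': "2 * k - 1 = m + 3" "2 * k - 4 = m" "2 * k - 3 = Suc m" using k by simp_all
  define P where "P s \<longleftrightarrow> s \<in> splines01 (m + 3) m \<tau> \<and> s \<in> extensional {0..1} \<and>
    (\<forall>i\<le>Suc m. s (\<tau> i) = f (\<tau> i) \<and> deriv01 s (\<tau> i) = deriv01 f (\<tau> i))" for s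
  have in01: "\<tau> i \<in> {0..1}" if "i \<le> Suc m" for i using tau_in[OF that] by simp
  obtain F where F: "spline_derivs F"
    "\<And>i. i \<le> Suc m \<Longrightarrow> F 0 (\<tau> i) = f (\<tau> i) \<and> F 1 (\<tau> i) = deriv01 f (\<tau> i)"
    using spline_hermite_exists[of "\<lambda>i. f (\<tau> i)" "\<lambda>i. deriv01 f (\<tau> i)"] by blast
  have der: "derivs01 (m + 2) F" using F(1) by (simp add: spline_derivs_def)
  define s where "s = restrict (F 0) {0..1}"
  have s: "s t = F 0 t" if "t \<in> {0..1}" for t using that by (simp add: s_def)
  have "P s"
    unfolding P_def
  proof (intro conjI allI impI)
    show "s \<in> splines01 (m + 3) m \<tau>" using F(1) s by (rule spline_derivs_splines01)
    show "s \<in> extensional {0..1}" by (simp add: s_def)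
    fix i assume i: "i \<le> Suc m"
    show "s (\<tau> i) = f (\<tau> i)" using s[OF in01[OF i]] F(2)[OF i] by simp
    have "(deriv01 ^^ 1) s (\<tau> i) = F 1 (\<tau> i)"
      by (rule derivs01_higher_deriv01[OF der s _ in01[OF i]]) simp_all
    then show "deriv01 s (\<tau> i) = deriv01 f (\<tau> i)" using F(2)[OF i] by simp
  qed
  moreover have "s1 = s2" if "P s1" "P s2" for s1 s2
  proof (rule extensionalityI)
    show "s1 \<in> extensional {0..1}" "s2 \<in> extensional {0..1}" using that by (simp_all add: P_def)
    fix t :: real assume t: "t \<in> {0..1}"
    have sp: "spline_derivs (\<lambda>i. (deriv01 ^^ i) s1)" "spline_derivs (\<lambda>i. (deriv01 ^^ i) s2)"
      using that splines01_spline_derivs by (simp_all add: P_def)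
    have "(deriv01 ^^ 0) s1 t - (deriv01 ^^ 0) s2 t = 0"
      using spline_derivs_diff[OF sp] _ _ t
      by (rule spline_hermite_unique) (use that in \<open>simp_all add: P_def\<close>)
    then show "s1 t = s2 t" by simp
  qed
  ultimately have "\<exists>!s. P s" by blast
  moreover have "hermite_spline k \<tau> f = (THE s. P s)"
    unfolding hermite_spline_def k' P_def ..
  ultimately have PH: "P (hermite_spline k \<tau> f)" by (simp add: theI')
  show ?thesis
  proof (rule that[of "\<lambda>i. (deriv01 ^^ i) (hermite_spline k \<tau> f)"])
    show "spline_derivs (\<lambda>i. (deriv01 ^^ i) (hermite_spline k \<tau> f))"
      using PH splines01_spline_derivs by (simp add: P_def)
  qed (use PH in \<open>simp_all add: P_def\<close>)
qed

section \<open>Comparison with the perfect spline\<close>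

text \<open>
  \<open>E\<close> is the error of the perfect spline and \<open>G - H\<close> that of the competitor, together with their
  derivatives.  Only the first \<open>m + 2\<close> derivatives of \<open>E\<close> and \<open>H\<close> are continuous, whereas \<open>G\<close> has \<open>m + 4\<close>.
\<close>
lemma perfect_error_maximal:
  assumes E: "derivs01 (m + 2) E"
    and Epiece: "\<And>j. j \<le> m \<Longrightarrow> \<exists>p. degree p \<le> m + 4 \<and> coeff p (m + 4) = (-1) ^ j / fact (m + 4) \<and>
      (\<forall>t\<in>{\<tau> j..\<tau> (Suc j)}. E 0 t = poly p t)"
    and E0: "\<And>i. i \<le> Suc m \<Longrightarrow> E 0 (\<tau> i) = 0" "\<And>i. i \<le> Suc m \<Longrightarrow> E 1 (\<tau> i) = 0"
    and G: "derivs01 (m + 4) G" "\<And>t. t \<in> {0..1} \<Longrightarrow> \<bar>G (m + 4) t\<bar> \<le> 1"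
    and H: "spline_derivs H"
    and GH: "\<And>i. i \<le> Suc m \<Longrightarrow> H 0 (\<tau> i) = G 0 (\<tau> i)" "\<And>i. i \<le> Suc m \<Longrightarrow> H 1 (\<tau> i) = G 1 (\<tau> i)"
    and t: "t \<in> {0..1}"
  shows "\<bar>G 0 t - H 0 t\<bar> \<le> \<bar>E 0 t\<bar>"
proof (rule ccontr)
  assume "\<not> ?thesis"
  then have gt: "\<bar>E 0 t\<bar> < \<bar>G 0 t - H 0 t\<bar>" by simp
  define c where "c = E 0 t / (G 0 t - H 0 t)"
  have c: "\<bar>c\<bar> < 1" using gt by (simp add: c_def)
  define W where "W i s = E i s - c * (G i s - H i s)" for i s
  have derH: "derivs01 (m + 2) H" using H by (simp add: spline_derivs_def)
  have "derivs01 (m + 2) G" using G(1) by (rule derivs01_mono) simp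
  then have W: "derivs01 (m + 2) W"
    unfolding W_def[abs_def] by (intro derivs01_diff derivs01_cmult E derH)
  have Wt: "W 0 t = 0" using gt by (auto simp: W_def c_def)
  have W0: "W 0 (\<tau> i) = 0" "W 1 (\<tau> i) = 0" if "i \<le> Suc m" for i
    using E0[OF that] GH[OF that] by (simp_all add: W_def)
  define N where "N = \<tau> ` {..Suc m}"
  have "inj_on \<tau> {..Suc m}"
    by (rule linorder_inj_onI) (use tau_less in force)+
  then have N: "finite N" "card N = m + 2" by (simp_all add: N_def card_image)
  have N01: "N \<subseteq> {0..1}" using tau_in by (auto simp: N_def)
  have "t \<notin> N" using gt GH by (auto simp: N_def)
  define Z where "Z = insert t N"
  have Z: "finite Z" "Z \<noteq> {}" "Z \<subseteq> {0..1}" "card Z = m + 3" "\<And>z. z \<in> Z \<Longrightarrow> W 0 z = 0"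
    using N N01 t \<open>t \<notin> N\<close> Wt W0 by (auto simp: Z_def N_def)
  obtain Y where Y: "finite Y" "Y \<subseteq> {0..<Max Z}" "Y \<inter> Z = {}" "\<forall>y\<in>Y. W 1 y = 0"
    "card Z = Suc (card Y)"
    using Rolle_finite[OF W _ Z(1,2,3,5)] by auto
  have "Max Z \<in> Z" using Z by simp
  then have "Max Z \<le> 1" using Z(3) by auto
  \<comment> \<open>The zeros of the first derivative: one between consecutive points of Z, and the double zeros at the nodes.\<close>
  define Y' where "Y' = Y \<union> N"
  have "Y \<inter> N = {}" using Y(3) by (auto simp: Z_def)
  then have "card Y' = (m + 3) + (m + 1)"
    using Y(1,5) Z(4) N by (simp add: Y'_def card_Un_disjoint)
  moreover have "finite Y'" "Y' \<subseteq> {0..1}"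
    using Y(1,2) N N01 \<open>Max Z \<le> 1\<close> by (auto simp: Y'_def)
  moreover have "W 1 y = 0" if "y \<in> Y'" for y
    using that Y(4) W0(2) by (auto simp: Y'_def N_def)
  ultimately obtain X where X: "finite X" "X \<subseteq> {0..1}" "\<forall>x\<in>X. W (1 + (m + 1)) x = 0" "card X = m + 3"
    using Rolle_iterated[OF W, of 1 "m + 1" Y' "m + 3"] by auto
  have "card X \<le> m + 2"
  proof (rule card_zeros_alternately_convex[of m \<tau> "W (m + 2)", OF tau_Suc _ X(1)])
    show "X \<subseteq> {\<tau> 0..\<tau> (Suc m)}" using X(2) tau_0 tau_1 by simp
    show "W (m + 2) z = 0" if "z \<in> X" for z using X(3) that by simp
    fix j assume j: "j \<le> m"
    have ab: "0 \<le> \<tau> j" "\<tau> j < \<tau> (Suc j)" "\<tau> (Suc j) \<le> 1"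
      using tau_in[of j] tau_in[of "Suc j"] tau_Suc[of j] j by simp_all
    then have sub: "{\<tau> j..\<tau> (Suc j)} \<subseteq> {0..1}" by auto
    obtain p where p: "degree p \<le> m + 4" "coeff p (m + 4) = (-1) ^ j / fact (m + 4)"
      "\<forall>t\<in>{\<tau> j..\<tau> (Suc j)}. E 0 t = poly p t"
      using Epiece[OF j] by blast
    from H j obtain q where q: "degree q \<le> m + 3" "\<forall>t\<in>{\<tau> j..\<tau> (Suc j)}. H 0 t = poly q t"
      unfolding spline_derivs_def by meson
    define P where "P = (pderiv ^^ (m + 2)) (p + Polynomial.smult c q)"
    have "pderiv (pderiv P) = (pderiv ^^ (m + 4)) (p + Polynomial.smult c q)"
      by (simp add: P_def numeral_eq_Suc)
    also have "\<dots> = [:fact (m + 4) * coeff (p + Polynomial.smult c q) (m + 4):]"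
      using p(1) q(1) by (intro higher_pderiv_degree degree_add_le order_trans[OF degree_smult_le]) simp_all
    also have "coeff (p + Polynomial.smult c q) (m + 4) = (-1) ^ j / fact (m + 4)"
      using p(2) q(1) by (simp add: coeff_eq_0)
    finally have P: "pderiv (pderiv P) = [:(-1) ^ j:]" by simp
    show "strictly_below_zero_between (\<lambda>t. (-1) ^ j * W (m + 2) t) (\<tau> j) (\<tau> (Suc j))"
    proof (rule strictly_below_zero_between_cong)
      fix s assume s: "s \<in> {\<tau> j..\<tau> (Suc j)}"
      have "E (m + 2) s = poly ((pderiv ^^ (m + 2)) p) s"
        using derivs01_piece_poly[OF E ab _ _ s, of p "m + 2"] p(3) by simp
      moreover have "H (m + 2) s = poly ((pderiv ^^ (m + 2)) q) s"
        using derivs01_piece_poly[OF derH ab _ _ s, of q "m + 2"] q(2) by simp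
      ultimately show "(-1) ^ j * W (m + 2) s = (-1) ^ j * (poly P s - c * G (m + 2) s)"
        unfolding W_def P_def higher_pderiv_add higher_pderiv_smult poly_add poly_smult
        by (simp add: algebra_simps)
    next
      show "strictly_below_zero_between (\<lambda>s. (-1) ^ j * (poly P s - c * G (m + 2) s)) (\<tau> j) (\<tau> (Suc j))"
      proof (rule perfect_piece_convex[OF _ _ _ c P])
        fix s assume s: "s \<in> {\<tau> j..\<tau> (Suc j)}"
        with sub have s01: "s \<in> {0..1}" by blast
        show "(G (m + 2) has_real_derivative G (m + 3) s) (at s within {\<tau> j..\<tau> (Suc j)})"
          using derivs01D[OF G(1) _ s01, of "m + 2"] sub
          by (intro DERIV_subset[OF _ sub]) (simp add: numeral_eq_Suc)
        show "(G (m + 3) has_real_derivative G (m + 4) s) (at s within {\<tau> j..\<tau> (Suc j)})"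
          using derivs01D[OF G(1) _ s01, of "m + 3"] sub
          by (intro DERIV_subset[OF _ sub]) (simp add: numeral_eq_Suc)
        show "\<bar>G (m + 4) s\<bar> \<le> 1" using G(2)[OF s01] .
      qed
    qed
  qed
  with X(4) show False by simp
qed

text \<open>
  Adding \<open>2 (-1)\<^sup>l (t - \<tau> l)\<^bsup>m+4\<^esup> / (m + 4)!\<close> for \<open>l = 1, \<dots>, j\<close> flips the sign of the leading
  coefficient at every knot, by \<open>alternating_sum\<close>.
\<close>
lemma perfect_spline_derivs:
  obtains D where "derivs01 (m + 2) D"
    "\<And>t. D 0 t = (\<Sum>i=0..m + 3. \<alpha> i * t ^ i) + (1 / fact (m + 4)) *
       (t ^ (m + 4) + 2 * (\<Sum>i=1..m. (-1) ^ i * (max (t - \<tau> i) 0) ^ (m + 4)))"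
    "\<And>j. j \<le> m \<Longrightarrow> \<exists>p. degree p \<le> m + 4 \<and> coeff p (m + 4) = (-1) ^ j / fact (m + 4) \<and>
      (\<forall>t\<in>{\<tau> j..\<tau> (Suc j)}. D 0 t = poly p t)"
proof -
  define A where "A = (\<Sum>i=0..m + 3. Polynomial.monom (\<alpha> i) i) + Polynomial.monom (1 / fact (m + 4)) (m + 4)"
  define c where "c i = (2 * (-1) ^ i / fact (m + 4) :: real)" for i :: nat
  define D where "D i t = poly ((pderiv ^^ i) A) t + (\<Sum>l=1..m. c l * truncated_power (m + 4) (\<tau> l) i t)" for i t
  have "derivs01 (m + 2) D"
    unfolding D_def[abs_def]
    by (intro derivs01_add derivs01_poly derivs01_sum derivs01_cmult derivs01_truncated_power) simp
  moreover have D0: "D 0 t = poly A t + (\<Sum>l=1..m. c l * max (t - \<tau> l) 0 ^ (m + 4))" for t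
    by (simp add: D_def truncated_power_0)
  have "D 0 t = (\<Sum>i=0..m + 3. \<alpha> i * t ^ i) + (1 / fact (m + 4)) *
       (t ^ (m + 4) + 2 * (\<Sum>i=1..m. (-1) ^ i * (max (t - \<tau> i) 0) ^ (m + 4)))" for t
  proof -
    have "(\<Sum>l=1..m. c l * max (t - \<tau> l) 0 ^ (m + 4)) =
        (1 / fact (m + 4)) * (2 * (\<Sum>i=1..m. (-1) ^ i * (max (t - \<tau> i) 0) ^ (m + 4)))"
      unfolding sum_distrib_left by (intro sum.cong) (simp_all add: c_def)
    moreover have "poly A t = (\<Sum>i=0..m + 3. \<alpha> i * t ^ i) + (1 / fact (m + 4)) * t ^ (m + 4)"
      by (simp add: A_def poly_sum poly_monom)
    ultimately show ?thesis unfolding D0 distrib_left by simp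
  qed
  moreover have "\<exists>p. degree p \<le> m + 4 \<and> coeff p (m + 4) = (-1) ^ j / fact (m + 4) \<and>
      (\<forall>t\<in>{\<tau> j..\<tau> (Suc j)}. D 0 t = poly p t)" if j: "j \<le> m" for j
  proof (intro exI conjI ballI)
    let ?p = "A + (\<Sum>l=1..j. Polynomial.smult (c l) ([:- \<tau> l, 1:] ^ (m + 4)))"
    have deg: "degree ([:- \<tau> l, 1:] ^ (m + 4)) = m + 4" for l by (simp add: degree_power_eq)
    have lead: "coeff ([:- \<tau> l, 1:] ^ (m + 4)) (m + 4) = 1" for l
      using lead_coeff_power[of "[:- \<tau> l, 1:]" "m + 4"] unfolding deg by simp
    have "degree A \<le> m + 4"
      unfolding A_def
      by (intro degree_add_le degree_sum_le order_trans[OF degree_monom_le]) simp_all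
    then show "degree ?p \<le> m + 4"
      by (intro degree_add_le degree_sum_le order_trans[OF degree_smult_le]) (simp_all add: deg)
    have "coeff A (m + 4) = 1 / fact (m + 4)" by (simp add: A_def coeff_sum)
    then have "coeff ?p (m + 4) = 1 / fact (m + 4) + (\<Sum>l=1..j. c l)"
      by (simp add: coeff_sum lead)
    also have "\<dots> = (1 + 2 * (\<Sum>l=1..j. (-1) ^ l)) / fact (m + 4)"
      by (simp add: c_def add_divide_distrib sum_distrib_left sum_divide_distrib)
    finally show "coeff ?p (m + 4) = (-1) ^ j / fact (m + 4)" unfolding alternating_sum .
    fix t assume t: "t \<in> {\<tau> j..\<tau> (Suc j)}"
    have "(\<Sum>l=1..m. c l * max (t - \<tau> l) 0 ^ (m + 4)) = (\<Sum>l=1..j. c l * (t - \<tau> l) ^ (m + 4))"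
    proof (rule sum.mono_neutral_cong_right)
      show "\<forall>l\<in>{1..m} - {1..j}. c l * max (t - \<tau> l) 0 ^ (m + 4) = 0"
      proof
        fix l assume l: "l \<in> {1..m} - {1..j}"
        then have "\<tau> (Suc j) \<le> \<tau> l" by (intro tau_le) auto
        then show "c l * max (t - \<tau> l) 0 ^ (m + 4) = 0" using t by simp
      qed
      fix l assume "l \<in> {1..j}"
      then have "\<tau> l \<le> \<tau> j" using j by (intro tau_le) auto
      then show "c l * max (t - \<tau> l) 0 ^ (m + 4) = c l * (t - \<tau> l) ^ (m + 4)" using t by simp
    qed (use j in auto)
    then show "D 0 t = poly ?p t" unfolding D0 by (simp add: poly_sum poly_power)
  qed
  ultimately show ?thesis using that by blast
qed

end

lemma sup_norm01_bound:
  assumes "continuous_on {0..1} g" "sup_norm01 g \<le> 1" "t \<in> {0..1}"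
  shows "\<bar>g t\<bar> \<le> 1"
proof -
  have "compact ((\<lambda>t. \<bar>g t\<bar>) ` {0..1})"
    using assms(1) by (intro compact_continuous_image continuous_on_rabs) auto
  then have "bdd_above ((\<lambda>t. \<bar>g t\<bar>) ` {0..1})"
    by (intro bounded_imp_bdd_above compact_imp_bounded)
  then have "\<bar>g t\<bar> \<le> sup_norm01 g"
    unfolding sup_norm01_def using assms(3) by (intro cSUP_upper)
  with assms(2) show ?thesis by simp
qed

theorem mainTheorem1:
  fixes k :: nat and \<tau> :: "nat \<Rightarrow> real" and \<alpha> :: "nat \<Rightarrow> real" and S :: "real \<Rightarrow> real"
  assumes "k \<ge> 3"
    and "\<tau> 0 = 0" and "\<tau> (2*k - 3) = 1"
    and "\<And>i. i < 2*k - 3 \<Longrightarrow> \<tau> i < \<tau> (Suc i)"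
    and "\<And>t. t \<in> {0..1} \<Longrightarrow>
           S t = (\<Sum>i=0..2*k - 1. \<alpha> i * t ^ i) +
             (1 / fact (2*k)) *
               (t ^ (2*k) + 2 * (\<Sum>i=1..2*k - 4. (-1) ^ i * (max (t - \<tau> i) 0) ^ (2*k)))"
    and "t \<in> {0..1}"
  shows "(SUP f \<in> {f \<in> C_class01 (2*k). sup_norm01 ((deriv01 ^^ (2*k)) f) \<le> 1}.
            ereal \<bar>f t - hermite_spline k \<tau> f t\<bar>)
         \<le> ereal \<bar>S t - hermite_spline k \<tau> S t\<bar>"
proof (rule SUP_least)
  fix f assume f: "f \<in> {f \<in> C_class01 (2*k). sup_norm01 ((deriv01 ^^ (2*k)) f) \<le> 1}"
  define m where "m = 2 * k - 4"
  have k: "2 * k = m + 4" "2 * k - 1 = m + 3" "2 * k - 3 = Suc m" "2 * k - 4 = m"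
    using \<open>k \<ge> 3\<close> by (simp_all add: m_def)
  interpret knots m \<tau>
    using assms(2-4) unfolding k(3) by unfold_locales simp_all
  obtain D where D: "derivs01 (m + 2) D"
    "\<And>t. D 0 t = (\<Sum>i=0..m + 3. \<alpha> i * t ^ i) + (1 / fact (m + 4)) *
       (t ^ (m + 4) + 2 * (\<Sum>i=1..m. (-1) ^ i * (max (t - \<tau> i) 0) ^ (m + 4)))"
    "\<And>j. j \<le> m \<Longrightarrow> \<exists>p. degree p \<le> m + 4 \<and> coeff p (m + 4) = (-1) ^ j / fact (m + 4) \<and>
      (\<forall>t\<in>{\<tau> j..\<tau> (Suc j)}. D 0 t = poly p t)"
    using perfect_spline_derivs[of \<alpha>] by blast
  have S: "S t = D 0 t" if "t \<in> {0..1}" for t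
    using assms(5)[OF that] unfolding k(2,4) unfolding k(1) D(2) .
  have in01: "\<tau> i \<in> {0..1}" if "i \<le> Suc m" for i using tau_in[OF that] by simp
  have S1: "deriv01 S (\<tau> i) = D 1 (\<tau> i)" if "i \<le> Suc m" for i
    using derivs01_higher_deriv01[OF D(1) S _ in01[OF that], of 1] by simp
  obtain H where H: "spline_derivs H" "\<And>t. t \<in> {0..1} \<Longrightarrow> hermite_spline k \<tau> S t = H 0 t"
    "\<And>i. i \<le> Suc m \<Longrightarrow> H 0 (\<tau> i) = S (\<tau> i)" "\<And>i. i \<le> Suc m \<Longrightarrow> H 1 (\<tau> i) = deriv01 S (\<tau> i)"
    using hermite_spline_derivs[OF k(1), of S] by blast
  obtain K where K: "spline_derivs K" "\<And>t. t \<in> {0..1} \<Longrightarrow> hermite_spline k \<tau> f t = K 0 t"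
    "\<And>i. i \<le> Suc m \<Longrightarrow> K 0 (\<tau> i) = f (\<tau> i)" "\<And>i. i \<le> Suc m \<Longrightarrow> K 1 (\<tau> i) = deriv01 f (\<tau> i)"
    using hermite_spline_derivs[OF k(1), of f] by blast
  have f': "f \<in> C_class01 (m + 4)" "sup_norm01 ((deriv01 ^^ (m + 4)) f) \<le> 1"
    using f unfolding k(1) by simp_all
  note derf = C_class01_derivs01[OF f'(1)]
  have derH: "derivs01 (m + 2) H" using H(1) by (simp add: spline_derivs_def)
  have "\<bar>(deriv01 ^^ 0) f t - K 0 t\<bar> \<le> \<bar>D 0 t - H 0 t\<bar>"
  proof (rule perfect_error_maximal[OF derivs01_diff[OF D(1) derH] _ _ _ derf _ K(1) _ _ \<open>t \<in> {0..1}\<close>])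
    fix j assume j: "j \<le> m"
    obtain p where p: "degree p \<le> m + 4" "coeff p (m + 4) = (-1) ^ j / fact (m + 4)"
      "\<forall>t\<in>{\<tau> j..\<tau> (Suc j)}. D 0 t = poly p t"
      using D(3)[OF j] by blast
    from H(1) j obtain q where q: "degree q \<le> m + 3" "\<forall>t\<in>{\<tau> j..\<tau> (Suc j)}. H 0 t = poly q t"
      unfolding spline_derivs_def by meson
    show "\<exists>p. degree p \<le> m + 4 \<and> coeff p (m + 4) = (-1) ^ j / fact (m + 4) \<and>
      (\<forall>t\<in>{\<tau> j..\<tau> (Suc j)}. D 0 t - H 0 t = poly p t)"
    proof (intro exI[of _ "p - q"] conjI ballI)
      show "degree (p - q) \<le> m + 4" using p(1) q(1) by (intro degree_diff_le) simp_all
      show "coeff (p - q) (m + 4) = (-1) ^ j / fact (m + 4)"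
        using p(2) q(1) by (simp add: coeff_eq_0)
    qed (use p(3) q(2) in simp)
  next
    fix s :: real assume "s \<in> {0..1}"
    then show "\<bar>(deriv01 ^^ (m + 4)) f s\<bar> \<le> 1"
      using derf f'(2) by (intro sup_norm01_bound) (simp_all add: derivs01_def)
  next
    fix i assume i: "i \<le> Suc m"
    show "D 0 (\<tau> i) - H 0 (\<tau> i) = 0" using H(3)[OF i] S[OF in01[OF i]] by simp
    show "D 1 (\<tau> i) - H 1 (\<tau> i) = 0" using H(4)[OF i] S1[OF i] by simp
    show "K 0 (\<tau> i) = (deriv01 ^^ 0) f (\<tau> i)" using K(3)[OF i] by simp
    show "K 1 (\<tau> i) = (deriv01 ^^ 1) f (\<tau> i)" using K(4)[OF i] by simp
  qed
  then show "ereal \<bar>f t - hermite_spline k \<tau> f t\<bar> \<le> ereal \<bar>S t - hermite_spline k \<tau> S t\<bar>"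
    using K(2) H(2) S \<open>t \<in> {0..1}\<close> by simp
qed

end
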